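(* There exists a constant $c>0$ such that for every constant $C$ there is a constant $K=K(C)$ with the following property: for every $m\ge2$, every tuple of positive integers $(a_1,\dots,a_m)$ with $\max_j a_j\le C e^{c\bar A}$, and every integer $k$, $$\left|\mathbb P(M_{a_1,\dots,a_m}=k)-\frac{1}{\sqrt{2\pi}\,\sigma}e^{-(k-\mu)^2/(2\sigma^2)}\right|\le \frac{K}{\sqrt{2\pi}\,\sigma\,\bar A}.$$
   Context: $M_{a_1,\dots,a_m}$ is the number of inversions (pairs of positions $i<j$ with $w_i>w_j$) of a word chosen uniformly at random among all words over $\{1,\dots,m\}$ containing exactly $a_i$ copies of letter $i$. $N=a_1+\dots+a_m$, $\bar A=N-\max_j a_j$, $\mu=e_2/2$ is the mean and $\sigma^2=\frac{(e_1+1)e_2-e_3}{12}$ the variance of $M_{a_1,\dots,a_m}$, with $e_k$ the $k$-th elementary symmetric polynomial of $a_1,\dots,a_m$. *)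

theory Defs
  imports "HOL-Probability.Probability"
begin

text \<open>
  A tuple \<open>(a\<^sub>1, \<dots>, a\<^sub>m)\<close> is a function \<open>a :: nat \<Rightarrow> nat\<close> together with its length \<open>m\<close>;
  only the values on \<open>{1..m}\<close> matter.
\<close>

definition words :: "nat \<Rightarrow> (nat \<Rightarrow> nat) \<Rightarrow> nat list set" where
  "words m a = {w. set w \<subseteq> {1..m} \<and> (\<forall>j\<in>{1..m}. count_list w j = a j)}"

definition inversions :: "nat list \<Rightarrow> nat" where
  "inversions w = card {(i, j). i < j \<and> j < length w \<and> w ! i > w ! j}"

text \<open>The distribution of \<open>M\<close>; \<open>words m a\<close> is finite and nonempty by the lemmas below, so
  \<^const>\<open>pmf_of_set\<close> is the uniform distribution on it.\<close>

definition inversions_pmf :: "nat \<Rightarrow> (nat \<Rightarrow> nat) \<Rightarrow> nat pmf" where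
  "inversions_pmf m a = map_pmf inversions (pmf_of_set (words m a))"

definition esym :: "nat \<Rightarrow> (nat \<Rightarrow> nat) \<Rightarrow> nat \<Rightarrow> real" where
  "esym m a k = (\<Sum>S | S \<subseteq> {1..m} \<and> card S = k. \<Prod>i\<in>S. real (a i))"

definition Abar :: "nat \<Rightarrow> (nat \<Rightarrow> nat) \<Rightarrow> nat" where
  "Abar m a = (\<Sum>j=1..m. a j) - Max (a ` {1..m})"

text \<open>The theorems \<open>expectation_inversions_pmf\<close> and \<open>variance_inversions_pmf\<close> show that these
  are the mean and the standard deviation of \<^const>\<open>inversions_pmf\<close>.\<close>

definition mu_inv :: "nat \<Rightarrow> (nat \<Rightarrow> nat) \<Rightarrow> real" where
  "mu_inv m a = esym m a 2 / 2"

definition sigma_inv :: "nat \<Rightarrow> (nat \<Rightarrow> nat) \<Rightarrow> real" where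
  "sigma_inv m a = sqrt (((esym m a 1 + 1) * esym m a 2 - esym m a 3) / 12)"

lemma length_words:
  assumes "w \<in> words m a"
  shows "length w = (\<Sum>j=1..m. a j)"
proof -
  have "length w = (\<Sum>j\<in>set w. count_list w j)"
    by (simp add: sum_count_set)
  also have "\<dots> = (\<Sum>j=1..m. count_list w j)"
    using assms by (intro sum.mono_neutral_left) (auto simp: words_def)
  also have "\<dots> = (\<Sum>j=1..m. a j)"
    using assms by (intro sum.cong) (auto simp: words_def)
  finally show ?thesis .
qed

lemma finite_words: "finite (words m a)"
proof (rule finite_subset)
  show "words m a \<subseteq> {w. set w \<subseteq> {1..m} \<and> length w = (\<Sum>j=1..m. a j)}"
    using length_words by (auto simp: words_def)
qed (rule finite_lists_length_eq, simp)

lemma words_nonempty: "words m a \<noteq> {}"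
proof -
  have c: "count_list (concat (map (\<lambda>j. replicate (a j) j) xs)) i = (if i \<in> set xs then a i else 0)"
    if "distinct xs" for xs :: "nat list" and i
    using that
  proof (induction xs)
    case (Cons x xs)
    have "count_list (replicate n x) i = (if i = x then n else 0)" for n
      by (induction n) auto
    with Cons show ?case by auto
  qed simp
  have "concat (map (\<lambda>j. replicate (a j) j) [1..<Suc m]) \<in> words m a"
    unfolding words_def using c[of "[1..<Suc m]"] by (auto simp del: upt_Suc)
  thus ?thesis by blast
qed

lemma inversions_Cons:
  "inversions (x # w) = inversions w + length (filter (\<lambda>y. y < x) w)"
proof -
  let ?A = "(\<lambda>j. (0::nat, Suc j)) ` {j. j < length w \<and> w ! j < x}"
  let ?B = "map_prod Suc Suc ` {(i, j). i < j \<and> j < length w \<and> w ! i > w ! j}"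
  have fin: "finite {(i, j). i < j \<and> j < length w \<and> w ! i > w ! j}"
    by (rule finite_subset[of _ "{..<length w} \<times> {..<length w}"]) auto
  have "{(i, j). i < j \<and> j < length (x # w) \<and> (x # w) ! i > (x # w) ! j} = ?A \<union> ?B" (is "?L = _")
  proof (intro equalityI subsetI)
    fix p assume p: "p \<in> ?L"
    obtain i j where ij: "p = (i, j)" by force
    show "p \<in> ?A \<union> ?B"
      using p ij by (cases i; cases j) (force simp: image_iff)+
  qed auto
  moreover have "?A \<inter> ?B = {}" by auto
  moreover have "card ?A = length (filter (\<lambda>y. y < x) w)"
    by (subst card_image) (auto simp: inj_on_def length_filter_conv_card)
  moreover have "card ?B = inversions w"
    by (subst card_image) (auto simp: inj_on_def inversions_def)
  ultimately show ?thesis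
    using fin by (simp add: inversions_def card_Un_disjoint)
qed

lemma length_filter_words:
  assumes "w \<in> words m a" "x \<in> {1..m}"
  shows "length (filter (\<lambda>y. y < x) w) = (\<Sum>i=1..<x. a i)"
proof -
  have "length (filter (\<lambda>y. y < x) w) = (\<Sum>i=1..<x. count_list w i)"
    if "set w \<subseteq> {1..m}" for w using that
  proof (induction w)
    case (Cons y w)
    have "(\<Sum>i=1..<x. count_list (y # w) i) = (\<Sum>i=1..<x. (if i = y then 1 else 0) + count_list w i)"
      by (intro sum.cong) auto
    thus ?case using Cons by (simp add: sum.distrib)
  qed simp
  also have "(\<Sum>i=1..<x. count_list w i) = (\<Sum>i=1..<x. a i)"
    using assms by (intro sum.cong) (auto simp: words_def)
  finally show ?thesis using assms by (auto simp: words_def)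
qed

lemma words_rec:
  assumes "(\<Sum>j=1..m. a j) > 0"
  shows "words m a = (\<Union>j\<in>{j\<in>{1..m}. a j > 0}. (#) j ` words m (a(j := a j - 1)))"
proof (intro equalityI subsetI)
  fix w assume w: "w \<in> words m a"
  with assms length_words obtain x v where [simp]: "w = x # v"
    by (cases w) fastforce+
  have x: "x \<in> {1..m}" using w by (auto simp: words_def)
  have "count_list (x # v) x = a x" using w x by (auto simp: words_def simp del: count_list.simps)
  hence cx: "Suc (count_list v x) = a x" by simp
  have "v \<in> words m (a(x := a x - 1))" using w cx by (auto simp: words_def)
  with x cx show "w \<in> (\<Union>j\<in>{j\<in>{1..m}. a j > 0}. (#) j ` words m (a(j := a j - 1)))"
    by auto
next
  fix w assume "w \<in> (\<Union>j\<in>{j\<in>{1..m}. a j > 0}. (#) j ` words m (a(j := a j - 1)))"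
  thus "w \<in> words m a" by (fastforce simp: words_def split: if_splits)
qed

definition word_sum :: "(nat \<Rightarrow> real) \<Rightarrow> nat \<Rightarrow> (nat \<Rightarrow> nat) \<Rightarrow> real" where
  "word_sum g m a = (\<Prod>j=1..m. fact (a j)) * (\<Sum>w\<in>words m a. g (inversions w))"

lemma word_sum_rec:
  assumes "(\<Sum>j=1..m. a j) > 0"
  shows "word_sum g m a = (\<Sum>j=1..m. real (a j) *
           word_sum (\<lambda>x. g (x + (\<Sum>i=1..<j. a i))) m (a(j := a j - 1)))"
proof -
  let ?J = "{j\<in>{1..m}. a j > 0}"
  have "(\<Sum>w\<in>words m a. g (inversions w)) =
        (\<Sum>j\<in>?J. \<Sum>w\<in>(#) j ` words m (a(j := a j - 1)). g (inversions w))"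
    unfolding words_rec[OF assms]
    by (rule sum.UNION_disjoint) (auto simp: finite_words)
  also have "\<dots> = (\<Sum>j\<in>?J. \<Sum>w\<in>words m (a(j := a j - 1)). g (inversions w + (\<Sum>i=1..<j. a i)))"
  proof (rule sum.cong[OF refl])
    fix j assume j: "j \<in> ?J"
    have "(\<Sum>w\<in>(#) j ` words m (a(j := a j - 1)). g (inversions w)) =
          (\<Sum>w\<in>words m (a(j := a j - 1)). g (inversions (j # w)))"
      by (subst sum.reindex) auto
    also have "\<dots> = (\<Sum>w\<in>words m (a(j := a j - 1)). g (inversions w + (\<Sum>i=1..<j. a i)))"
      using j by (intro sum.cong refl)
        (auto simp: inversions_Cons length_filter_words intro!: arg_cong[where f = g] sum.cong)
    finally show "(\<Sum>w\<in>(#) j ` words m (a(j := a j - 1)). g (inversions w)) =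
      (\<Sum>w\<in>words m (a(j := a j - 1)). g (inversions w + (\<Sum>i=1..<j. a i)))" .
  qed
  finally have 1: "word_sum g m a = (\<Sum>j\<in>?J. (\<Prod>j=1..m. fact (a j)) *
      (\<Sum>w\<in>words m (a(j := a j - 1)). g (inversions w + (\<Sum>i=1..<j. a i))))"
    by (simp add: word_sum_def sum_distrib_left)
  also have "\<dots> = (\<Sum>j\<in>?J. real (a j) * word_sum (\<lambda>x. g (x + (\<Sum>i=1..<j. a i))) m (a(j := a j - 1)))"
  proof (intro sum.cong refl)
    fix j assume j: "j \<in> ?J"
    let ?b = "a(j := a j - 1)"
    have "(\<Prod>i=1..m. fact (a i)) = (fact (a j) :: real) * (\<Prod>i\<in>{1..m} - {j}. fact (a i))"
      using j by (intro prod.remove) auto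
    also have "(\<Prod>i\<in>{1..m} - {j}. fact (a i)) = (\<Prod>i\<in>{1..m} - {j}. fact (?b i) :: real)"
      by (intro prod.cong) auto
    also have "(fact (a j) :: real) = real (a j) * fact (?b j)"
      using j by (simp add: fact_reduce)
    also have "real (a j) * fact (?b j) * (\<Prod>i\<in>{1..m} - {j}. fact (?b i) :: real) =
               real (a j) * (\<Prod>i=1..m. fact (?b i))"
      using j by (subst prod.remove[of "{1..m}" j]) auto
    finally show "(\<Prod>j=1..m. fact (a j)) *
        (\<Sum>w\<in>words m ?b. g (inversions w + (\<Sum>i=1..<j. a i))) =
        real (a j) * word_sum (\<lambda>x. g (x + (\<Sum>i=1..<j. a i))) m ?b"
      by (simp add: word_sum_def)
  qed
  also have "\<dots> = (\<Sum>j=1..m. real (a j) * word_sum (\<lambda>x. g (x + (\<Sum>i=1..<j. a i))) m (a(j := a j - 1)))"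
    by (rule sum.mono_neutral_left) auto
  finally show ?thesis .
qed

definition psum :: "nat \<Rightarrow> (nat \<Rightarrow> nat) \<Rightarrow> nat \<Rightarrow> real" where
  "psum m a r = (\<Sum>j=1..m. real (a j) ^ r)"

lemma psum_upd:
  assumes "j \<in> {1..m}" "a j > 0"
  shows "psum m (a(j := a j - 1)) r = psum m a r - real (a j) ^ r + (real (a j) - 1) ^ r"
proof -
  have "(\<Sum>i\<in>{1..m} - {j}. real ((a(j := a j - 1)) i) ^ r) = (\<Sum>i\<in>{1..m} - {j}. real (a i) ^ r)"
    by (intro sum.cong) auto
  thus ?thesis
    using assms sum.remove[of "{1..m}" j "\<lambda>i. real (a i) ^ r"]
      sum.remove[of "{1..m}" j "\<lambda>i. real ((a(j := a j - 1)) i) ^ r"]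
    unfolding psum_def by (simp add: of_nat_diff del: fun_upd_apply) (simp add: of_nat_diff)
qed

lemma esym_0 [simp]: "esym m a 0 = 1"
proof -
  have "{S. S \<subseteq> {1..m} \<and> card S = 0} = {{}}"
    by (auto dest: finite_subset)
  thus ?thesis by (simp add: esym_def)
qed

lemma esym_0_Suc [simp]: "esym 0 a (Suc k) = 0"
  by (auto simp: esym_def)

lemma esym_Suc_Suc: "esym (Suc m) a (Suc k) = esym m a (Suc k) + real (a (Suc m)) * esym m a k"
proof -
  let ?A = "{S. S \<subseteq> {1..m} \<and> card S = Suc k}"
  let ?B = "{S. S \<subseteq> {1..m} \<and> card S = k}"
  have fin: "finite S" if "S \<subseteq> {1..m}" for S using that by (rule finite_subset) simp
  have ni: "Suc m \<notin> S" if "S \<subseteq> {1..m}" for S using that by auto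
  have eq: "{S. S \<subseteq> {1..Suc m} \<and> card S = Suc k} = ?A \<union> insert (Suc m) ` ?B" (is "?L = _")
  proof (intro equalityI subsetI)
    fix S assume S: "S \<in> ?L"
    show "S \<in> ?A \<union> insert (Suc m) ` ?B"
    proof (cases "Suc m \<in> S")
      case True
      have "S - {Suc m} \<in> ?B" using S True by (auto simp: le_Suc_eq)
      moreover have "S = insert (Suc m) (S - {Suc m})" using True by auto
      ultimately show ?thesis by blast
    next
      case False
      thus ?thesis using S by (auto simp: le_Suc_eq)
    qed
  next
    fix S assume "S \<in> ?A \<union> insert (Suc m) ` ?B"
    thus "S \<in> ?L" using fin ni by (auto simp: card_insert_if)
  qed
  have "esym (Suc m) a (Suc k) =
      (\<Sum>S\<in>?A. \<Prod>i\<in>S. real (a i)) + (\<Sum>S\<in>insert (Suc m) ` ?B. \<Prod>i\<in>S. real (a i))"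
    unfolding esym_def eq using ni by (intro sum.union_disjoint) auto
  also have "(\<Sum>S\<in>insert (Suc m) ` ?B. \<Prod>i\<in>S. real (a i)) =
      (\<Sum>S\<in>?B. \<Prod>i\<in>insert (Suc m) S. real (a i))"
    using ni by (subst sum.reindex) (auto simp: inj_on_def dest!: insert_ident[THEN iffD1, rotated 2])
  also have "\<dots> = (\<Sum>S\<in>?B. real (a (Suc m)) * (\<Prod>i\<in>S. real (a i)))"
    using ni fin by (intro sum.cong refl) auto
  finally show ?thesis by (simp add: esym_def sum_distrib_left)
qed

lemma esym_psum:
  "esym m a 1 = psum m a 1"
  "esym m a 2 = ((psum m a 1)\<^sup>2 - psum m a 2) / 2"
  "esym m a 3 = (psum m a 1 ^ 3 - 3 * psum m a 1 * psum m a 2 + 2 * psum m a 3) / 6"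
proof -
  have *: "psum 0 a r = 0" "psum (Suc m) a r = psum m a r + real (a (Suc m)) ^ r" for r m
    by (simp_all add: psum_def)
  have 1: "esym m a (Suc 0) = psum m a 1" for m
    by (induction m) (simp_all add: * esym_Suc_Suc)
  have 2: "esym m a (Suc (Suc 0)) = ((psum m a 1)\<^sup>2 - psum m a 2) / 2" for m
    by (induction m) (simp_all add: * esym_Suc_Suc 1 field_simps power2_eq_square)
  have 3: "esym m a (Suc (Suc (Suc 0))) =
      (psum m a 1 ^ 3 - 3 * psum m a 1 * psum m a 2 + 2 * psum m a 3) / 6" for m
    by (induction m)
      (simp_all add: * esym_Suc_Suc 2 field_simps power2_eq_square power3_eq_cube)
  show "esym m a 1 = psum m a 1"
    "esym m a 2 = ((psum m a 1)\<^sup>2 - psum m a 2) / 2"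
    "esym m a 3 = (psum m a 1 ^ 3 - 3 * psum m a 1 * psum m a 2 + 2 * psum m a 3) / 6"
    using 1[of m] 2[of m] 3[of m] by (simp_all add: numeral_2_eq_2 numeral_3_eq_3)
qed

lemma partial_sums:
  fixes a :: "nat \<Rightarrow> nat" and m :: nat
  defines "s \<equiv> \<lambda>j. \<Sum>i=1..<j. real (a i)"
  shows "(\<Sum>j=1..m. real (a j) * s j) = ((psum m a 1)\<^sup>2 - psum m a 2) / 2"
    and "(\<Sum>j=1..m. real (a j) * (s j)\<^sup>2 + (real (a j))\<^sup>2 * s j) = (psum m a 1 ^ 3 - psum m a 3) / 3"
proof -
  have *: "psum 0 a r = 0" "psum (Suc m) a r = psum m a r + real (a (Suc m)) ^ r" for r m
    by (simp_all add: psum_def)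
  have s: "s (Suc m) = psum m a 1" for m
    unfolding s_def psum_def atLeastLessThanSuc_atLeastAtMost by simp
  show "(\<Sum>j=1..m. real (a j) * s j) = ((psum m a 1)\<^sup>2 - psum m a 2) / 2"
    by (induction m) (simp_all add: * s field_simps power2_eq_square)
  show "(\<Sum>j=1..m. real (a j) * (s j)\<^sup>2 + (real (a j))\<^sup>2 * s j) = (psum m a 1 ^ 3 - psum m a 3) / 3"
    by (induction m) (simp_all add: * s field_simps power2_eq_square power3_eq_cube)
qed

definition var_poly :: "real \<Rightarrow> real \<Rightarrow> real \<Rightarrow> real" where
  "var_poly p q r = ((p + 1) * ((p\<^sup>2 - q) / 2) - (p ^ 3 - 3 * p * q + 2 * r) / 6) / 12"

lemma word_sum_add: "word_sum (\<lambda>x. f x + g x) m a = word_sum f m a + word_sum g m a"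
  by (simp add: word_sum_def sum.distrib distrib_left)

lemma word_sum_cmult: "word_sum (\<lambda>x. c * f x) m a = c * word_sum f m a"
  by (simp add: word_sum_def sum_distrib_left mult.left_commute)

lemma word_sum_moments:
  "word_sum (\<lambda>_. 1) m a = fact (\<Sum>j=1..m. a j) \<and>
   word_sum real m a = fact (\<Sum>j=1..m. a j) * (((psum m a 1)\<^sup>2 - psum m a 2) / 4) \<and>
   word_sum (\<lambda>x. (real x)\<^sup>2) m a = fact (\<Sum>j=1..m. a j) *
     (var_poly (psum m a 1) (psum m a 2) (psum m a 3) + (((psum m a 1)\<^sup>2 - psum m a 2) / 4)\<^sup>2)"
proof (induction "\<Sum>j=1..m. a j" arbitrary: a)
  case 0
  hence z: "a j = 0" if "j \<in> {1..m}" for j using that by simp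
  have "words m a = {[]}"
    using length_words[of _ m a] 0 words_nonempty[of m a] by fastforce
  hence f: "word_sum g m a = g 0" for g
    using z by (simp add: word_sum_def inversions_def)
  have "psum m a 1 = 0" "psum m a 2 = 0" "psum m a 3 = 0"
    using z by (simp_all add: psum_def)
  thus ?case using 0[symmetric] by (simp add: f var_poly_def)
next
  case (Suc n)
  define s where "s = (\<lambda>j. \<Sum>i=1..<j. real (a i))"
  define p q r where pqr: "p = psum m a 1" "q = psum m a 2" "r = psum m a 3"
  define F where "F = (fact n :: real)"
  define M where "M = (\<lambda>j. ((p - 1)\<^sup>2 - (q - 2 * real (a j) + 1)) / 4)"
  define V where "V = (\<lambda>j. var_poly (p - 1) (q - 2 * real (a j) + 1)
                          (r - 3 * (real (a j))\<^sup>2 + 3 * real (a j) - 1))"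
  have p_eq: "p = real n + 1"
    using Suc(2) by (simp add: pqr psum_def flip: of_nat_sum)
  have F: "fact (\<Sum>j=1..m. a j) = p * F"
    using Suc(2)[symmetric] by (simp add: p_eq F_def)
  have pos: "(\<Sum>j=1..m. a j) > 0" using Suc(2) by simp
  have IH: "word_sum (\<lambda>_. 1) m (a(j := a j - 1)) = F \<and>
     word_sum real m (a(j := a j - 1)) = F * M j \<and>
     word_sum (\<lambda>x. (real x)\<^sup>2) m (a(j := a j - 1)) = F * (V j + (M j)\<^sup>2)"
    if j: "j \<in> {1..m}" "a j > 0" for j
  proof -
    have "(\<Sum>i\<in>{1..m} - {j}. (a(j := a j - 1)) i) = (\<Sum>i\<in>{1..m} - {j}. a i)"
      by (intro sum.cong) auto
    hence n: "n = (\<Sum>i=1..m. (a(j := a j - 1)) i)"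
      using j Suc(2) sum.remove[of "{1..m}" j a] sum.remove[of "{1..m}" j "a(j := a j - 1)"]
      by simp
    have ps: "psum m (a(j := a j - 1)) 1 = p - 1"
      "psum m (a(j := a j - 1)) 2 = q - 2 * real (a j) + 1"
      "psum m (a(j := a j - 1)) 3 = r - 3 * (real (a j))\<^sup>2 + 3 * real (a j) - 1"
      unfolding psum_upd[where a = a and j = j, OF j] pqr
      by (simp_all add: power2_eq_square power3_eq_cube algebra_simps)
    show ?thesis
      using Suc(1)[OF n] unfolding n[symmetric] ps F_def[symmetric] M_def V_def .
  qed
  have sr: "real (\<Sum>i=1..<j. a i) = s j" for j by (simp add: s_def)
  have S1: "(\<Sum>j=1..m. real (a j)) = p" "(\<Sum>j=1..m. (real (a j))\<^sup>2) = q"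
      "(\<Sum>j=1..m. real (a j) ^ 3) = r"
    by (simp_all add: pqr psum_def)
  have S2: "(\<Sum>j=1..m. real (a j) * s j) = (p\<^sup>2 - q) / 2"
      "(\<Sum>j=1..m. real (a j) * (s j)\<^sup>2 + (real (a j))\<^sup>2 * s j) = (p ^ 3 - r) / 3"
    using partial_sums[of a m] by (simp_all add: s_def pqr)
  have "word_sum (\<lambda>_. 1) m a = (\<Sum>j=1..m. real (a j) * F)"
    unfolding word_sum_rec[OF pos] using IH by (intro sum.cong refl) auto
  also have "\<dots> = p * F" by (simp only: S1 flip: sum_distrib_right)
  finally have T0: "word_sum (\<lambda>_. 1) m a = p * F" .

  have "word_sum real m a = (\<Sum>j=1..m. real (a j) * (F * (M j + s j)))"
    unfolding word_sum_rec[OF pos]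
  proof (intro sum.cong refl)
    fix j assume j: "j \<in> {1..m}"
    have "word_sum (\<lambda>x. real (x + (\<Sum>i=1..<j. a i))) m b = word_sum real m b + s j * word_sum (\<lambda>_. 1) m b" for b
      unfolding of_nat_add sr using word_sum_cmult[of "s j" "\<lambda>_. 1" m b] by (simp add: word_sum_add)
    thus "real (a j) * word_sum (\<lambda>x. real (x + (\<Sum>i=1..<j. a i))) m (a(j := a j - 1)) =
          real (a j) * (F * (M j + s j))"
      using IH[OF j] by (cases "a j > 0") (simp_all add: algebra_simps)
  qed
  also have "\<dots> = F * (\<Sum>j=1..m. ((p - 1)\<^sup>2 - q - 1) / 4 * real (a j)
                     + (real (a j))\<^sup>2 / 2 + real (a j) * s j)"
    unfolding sum_distrib_left
    by (intro sum.cong refl) (simp add: M_def field_simps power2_eq_square)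
  also have "(\<Sum>j=1..m. ((p - 1)\<^sup>2 - q - 1) / 4 * real (a j)
                     + (real (a j))\<^sup>2 / 2 + real (a j) * s j) =
             ((p - 1)\<^sup>2 - q - 1) / 4 * p + q / 2 + (p\<^sup>2 - q) / 2"
    unfolding sum.distrib sum_distrib_left[symmetric] sum_divide_distrib[symmetric] S1 S2 ..
  also have "F * \<dots> = p * F * ((p\<^sup>2 - q) / 4)"
    by (simp add: field_simps power2_eq_square)
  finally have T1: "word_sum real m a = p * F * ((p\<^sup>2 - q) / 4)" .

  define k where "k = ((p - 1)\<^sup>2 - q - 1) / 4"
  define v where "v = var_poly (p - 1) (q + 1) (r - 1)"
  have "word_sum (\<lambda>x. (real x)\<^sup>2) m a =
        (\<Sum>j=1..m. real (a j) * (F * (V j + (M j)\<^sup>2 + 2 * s j * M j + (s j)\<^sup>2)))"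
    unfolding word_sum_rec[OF pos]
  proof (intro sum.cong refl)
    fix j assume j: "j \<in> {1..m}"
    have "word_sum (\<lambda>x. (real (x + (\<Sum>i=1..<j. a i)))\<^sup>2) m b =
          word_sum (\<lambda>x. (real x)\<^sup>2 + 2 * s j * real x + (s j)\<^sup>2 * 1) m b" for b
      unfolding of_nat_add sr by (simp add: power2_sum algebra_simps)
    hence "word_sum (\<lambda>x. (real (x + (\<Sum>i=1..<j. a i)))\<^sup>2) m b =
          word_sum (\<lambda>x. (real x)\<^sup>2) m b + 2 * s j * word_sum real m b + (s j)\<^sup>2 * word_sum (\<lambda>_. 1) m b" for b
      unfolding word_sum_add word_sum_cmult .
    thus "real (a j) * word_sum (\<lambda>x. (real (x + (\<Sum>i=1..<j. a i)))\<^sup>2) m (a(j := a j - 1)) =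
          real (a j) * (F * (V j + (M j)\<^sup>2 + 2 * s j * M j + (s j)\<^sup>2))"
      using IH[OF j] by (cases "a j > 0") (simp_all add: algebra_simps)
  qed
  also have "\<dots> = F * (\<Sum>j=1..m. (v + k\<^sup>2) * real (a j) + k * (real (a j))\<^sup>2
        + real (a j) ^ 3 / 3 + 2 * k * (real (a j) * s j)
        + (real (a j) * (s j)\<^sup>2 + (real (a j))\<^sup>2 * s j))"
    unfolding sum_distrib_left
  proof (intro sum.cong refl)
    fix j
    have e: "V j = v + (real (a j))\<^sup>2 / 12" "M j = k + real (a j) / 2"
      by (simp_all add: V_def v_def M_def k_def var_poly_def field_simps
            power2_eq_square power3_eq_cube)
    show "real (a j) * (F * (V j + (M j)\<^sup>2 + 2 * s j * M j + (s j)\<^sup>2)) =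
        F * ((v + k\<^sup>2) * real (a j) + k * (real (a j))\<^sup>2
        + real (a j) ^ 3 / 3 + 2 * k * (real (a j) * s j)
        + (real (a j) * (s j)\<^sup>2 + (real (a j))\<^sup>2 * s j))"
      unfolding e by (simp add: field_simps power2_eq_square power3_eq_cube)
  qed
  also have "\<dots> = F * ((v + k\<^sup>2) * p + k * q + r / 3 + 2 * k * ((p\<^sup>2 - q) / 2) + (p ^ 3 - r) / 3)"
    unfolding sum.distrib sum_distrib_left[symmetric] sum_divide_distrib[symmetric]
      S1 S2(1) S2(2)[unfolded sum.distrib] ..
  also have "\<dots> = p * F * (var_poly p q r + ((p\<^sup>2 - q) / 4)\<^sup>2)"
    unfolding v_def k_def var_poly_def
    by (simp add: field_simps power2_eq_square power3_eq_cube)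
  finally have T2: "word_sum (\<lambda>x. (real x)\<^sup>2) m a = \<dots>" .
  show ?case
    unfolding F using T0 T1 T2 unfolding pqr by blast
qed

lemma expectation_word_sum:
  "measure_pmf.expectation (inversions_pmf m a) f = word_sum f m a / fact (\<Sum>j=1..m. a j)"
proof -
  define P :: real where "P = (\<Prod>j=1..m. fact (a j))"
  have P: "P > 0" unfolding P_def by (intro prod_pos) auto
  have c: "P * card (words m a) = fact (\<Sum>j=1..m. a j)"
    using word_sum_moments[of m a] by (simp add: word_sum_def P_def)
  have "measure_pmf.expectation (inversions_pmf m a) f =
        (\<Sum>w\<in>words m a. f (inversions w)) / card (words m a)"
    by (simp add: inversions_pmf_def integral_pmf_of_set finite_words words_nonempty)
  thus ?thesis
    using P unfolding c[symmetric] word_sum_def P_def[symmetric] by simp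
qed

lemma finite_set_inversions_pmf: "finite (set_pmf (inversions_pmf m a))"
  by (simp add: inversions_pmf_def finite_words words_nonempty)

theorem expectation_inversions_pmf:
  "measure_pmf.expectation (inversions_pmf m a) real = mu_inv m a"
  using word_sum_moments[of m a] by (simp add: expectation_word_sum mu_inv_def esym_psum)

theorem variance_inversions_pmf:
  "measure_pmf.variance (inversions_pmf m a) real = (sigma_inv m a)\<^sup>2"
proof -
  have "measure_pmf.variance (inversions_pmf m a) real =
      measure_pmf.expectation (inversions_pmf m a) (\<lambda>x. (real x)\<^sup>2)
      - (measure_pmf.expectation (inversions_pmf m a) real)\<^sup>2"
    by (intro measure_pmf.variance_eq integrable_measure_pmf_finite finite_set_inversions_pmf)
  also have "\<dots> = var_poly (psum m a 1) (psum m a 2) (psum m a 3)"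
    using word_sum_moments[of m a] by (simp add: expectation_word_sum del: times_divide_eq_right)
  also have "\<dots> = ((esym m a 1 + 1) * esym m a 2 - esym m a 3) / 12"
    by (simp only: var_poly_def esym_psum)
  finally have *: "measure_pmf.variance (inversions_pmf m a) real =
    ((esym m a 1 + 1) * esym m a 2 - esym m a 3) / 12" .
  moreover have "measure_pmf.variance (inversions_pmf m a) real \<ge> 0"
    by (rule measure_pmf.variance_positive)
  ultimately show ?thesis unfolding sigma_inv_def by (metis real_sqrt_pow2)
qed

end

theory Submission
  imports Defs "HOL-Computational_Algebra.Polynomial"
begin

text \<open>
  The inversion generating function of words is the q-multinomial coefficient, which gives the
  characteristic function of \<open>M\<close> in closed form, and Fourier inversion compares it with that of the
  Gaussian. For \<open>\<bar>t\<bar> \<le> 1 / (2 N)\<close>, the logarithms of the factors \<open>sin (j t / 2) / (j sin (t / 2))\<close> are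
  expanded; after cancelling the factors of the largest letter only \<open>2 A\<close> of them remain
  (\<open>A = N - max a\<^sub>j\<close>), so the error in the exponent is \<open>O(A N\<^sup>4 t\<^sup>4)\<close>, while \<open>\<sigma>\<^sup>2\<close> has order \<open>N\<^sup>2 A\<close>.
  For larger \<open>t\<close>, the letters are grouped into two classes with at least \<open>A / 3\<close> elements each.
  This bounds the characteristic function by that of a normalised q-binomial coefficient, which in
  turn is a coefficient of \<open>\<Prod>j<N. 1 + z q\<^sup>j\<close>. Since \<open>\<bar>\<Sum>j<N. q\<^sup>j\<bar>\<close> is at most a fixed fraction of \<open>N\<close>,
  the arguments of \<open>z q\<^sup>j\<close> are spread out and the product on a suitable circle is exponentially smaller
  than the trivial bound \<open>(1 + \<bar>z\<bar>)\<^sup>N\<close>. This leaves \<open>(N + 1) exp (- c A)\<close>, and the growth hypothesis absorbs \<open>N\<close>.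
\<close>

section \<open>The inversion generating function and q-binomial coefficients\<close>

text \<open>The ring stays general because the identities are needed both for complex
  \<open>q\<close> and in the polynomial ring, where q-factorials can be cancelled.\<close>

definition inv_gf :: "nat \<Rightarrow> (nat \<Rightarrow> nat) \<Rightarrow> 'a::comm_ring_1 \<Rightarrow> 'a" where
  "inv_gf m a q = (\<Sum>w\<in>words m a. q ^ inversions w)"

text \<open>The q-integer \<open>(1 - q ^ n) / (1 - q)\<close>, written as a sum so that it also
  makes sense at \<open>q = 1\<close>.\<close>

definition qnum :: "'a::comm_ring_1 \<Rightarrow> nat \<Rightarrow> 'a" where
  "qnum q n = (\<Sum>i<n. q ^ i)"

definition qfact :: "'a::comm_ring_1 \<Rightarrow> nat \<Rightarrow> 'a" where
  "qfact q n = (\<Prod>j=1..n. qnum q j)"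

lemma qnum_0 [simp]: "qnum q 0 = 0"
  by (simp add: qnum_def)

lemma qnum_add: "qnum q (i + j) = qnum q i + q ^ i * qnum q j"
  by (induction j) (simp_all add: qnum_def algebra_simps power_add)

lemma qfact_0 [simp]: "qfact q 0 = 1"
  by (simp add: qfact_def)

lemma qfact_Suc: "qfact q (Suc n) = qnum q (Suc n) * qfact q n"
  by (simp add: qfact_def mult.commute)

lemma qnum_one: "qnum 1 n = of_nat n"
  by (simp add: qnum_def)

lemma qfact_one: "qfact 1 n = fact n"
  by (induction n) (simp_all add: qfact_Suc qnum_one)

text \<open>The exponents below the total are cut into consecutive blocks of lengths
  \<open>a j\<close>. This produces exactly the weights that occur in
  \<open>inv_gf_rec\<close>.\<close>

lemma qnum_sum:
  fixes m :: nat
  shows "qnum q (\<Sum>j=1..m. a j) = (\<Sum>j=1..m. q ^ (\<Sum>i=1..<j. a i) * qnum q (a j))"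
  by (induction m) (simp_all add: qnum_add atLeastLessThanSuc_atLeastAtMost)

text \<open>Words are sorted by their first letter: a leading \<open>j\<close> forms an inversion
  with each smaller letter after it, and there are \<open>\<Sum>i=1..<j. a i\<close> of
  those.\<close>

lemma inv_gf_rec:
  assumes "(\<Sum>j=1..m. a j) > 0"
  shows "inv_gf m a q =
    (\<Sum>j\<in>{j\<in>{1..m}. a j > 0}. q ^ (\<Sum>i=1..<j. a i) * inv_gf m (a(j := a j - 1)) q)"
proof -
  let ?J = "{j\<in>{1..m}. a j > 0}"
  have "inv_gf m a q = (\<Sum>j\<in>?J. \<Sum>w\<in>(#) j ` words m (a(j := a j - 1)). q ^ inversions w)"
    unfolding inv_gf_def words_rec[OF assms]
    by (rule sum.UNION_disjoint) (auto simp: finite_words)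
  also have "\<dots> = (\<Sum>j\<in>?J. q ^ (\<Sum>i=1..<j. a i) * inv_gf m (a(j := a j - 1)) q)"
  proof (rule sum.cong[OF refl])
    fix j assume j: "j \<in> ?J"
    have "(\<Sum>w\<in>(#) j ` words m (a(j := a j - 1)). q ^ inversions w) =
          (\<Sum>w\<in>words m (a(j := a j - 1)). q ^ inversions (j # w))"
      by (subst sum.reindex) auto
    also have "\<dots> = (\<Sum>w\<in>words m (a(j := a j - 1)). q ^ (\<Sum>i=1..<j. a i) * q ^ inversions w)"
    proof (rule sum.cong[OF refl])
      fix w assume w: "w \<in> words m (a(j := a j - 1))"
      have "(\<Sum>i=1..<j. (a(j := a j - 1)) i) = (\<Sum>i=1..<j. a i)"
        by (intro sum.cong) auto
      thus "q ^ inversions (j # w) = q ^ (\<Sum>i=1..<j. a i) * q ^ inversions w"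
        using j w by (simp add: inversions_Cons length_filter_words power_add)
    qed
    finally show "(\<Sum>w\<in>(#) j ` words m (a(j := a j - 1)). q ^ inversions w) =
        q ^ (\<Sum>i=1..<j. a i) * inv_gf m (a(j := a j - 1)) q"
      by (simp add: inv_gf_def sum_distrib_left)
  qed
  finally show ?thesis .
qed

text \<open>MacMahon's theorem, kept as a product because q-factorials vanish at some roots of
  unity. In the induction, removing a letter \<open>j\<close> frees a factor
  \<open>qnum q (a j)\<close>, and \<open>qnum_sum\<close> adds these up to the next factor of the
  q-factorial.\<close>

lemma inv_gf_qfact:
  "inv_gf m a q * (\<Prod>j=1..m. qfact q (a j)) = qfact q (\<Sum>j=1..m. a j)"
proof (induction "\<Sum>j=1..m. a j" arbitrary: a)
  case 0
  hence z: "a j = 0" if "j \<in> {1..m}" for j using that by simp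
  have "words m a = {[]}"
    using length_words[of _ m a] 0 words_nonempty[of m a] by fastforce
  thus ?case using z 0[symmetric] by (simp add: inv_gf_def inversions_def)
next
  case (Suc n)
  let ?J = "{j\<in>{1..m}. a j > 0}"
  let ?s = "\<lambda>j. \<Sum>i=1..<j. a i"
  have "inv_gf m a q * (\<Prod>j=1..m. qfact q (a j)) =
      (\<Sum>j\<in>?J. q ^ ?s j * inv_gf m (a(j := a j - 1)) q * (\<Prod>j=1..m. qfact q (a j)))"
    using Suc(2) by (simp add: inv_gf_rec sum_distrib_right)
  also have "\<dots> = (\<Sum>j\<in>?J. q ^ ?s j * qnum q (a j) * qfact q n)"
  proof (intro sum.cong refl)
    fix j assume j: "j \<in> ?J"
    let ?b = "a(j := a j - 1)"
    have "(\<Sum>i\<in>{1..m} - {j}. ?b i) = (\<Sum>i\<in>{1..m} - {j}. a i)"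
      by (intro sum.cong) auto
    hence n: "n = (\<Sum>i=1..m. ?b i)"
      using j Suc(2) sum.remove[of "{1..m}" j a] sum.remove[of "{1..m}" j ?b] by simp
    have "(\<Prod>i=1..m. qfact q (a i)) = qfact q (a j) * (\<Prod>i\<in>{1..m} - {j}. qfact q (a i))"
      using j by (intro prod.remove) auto
    also have "(\<Prod>i\<in>{1..m} - {j}. qfact q (a i)) = (\<Prod>i\<in>{1..m} - {j}. qfact q (?b i))"
      by (intro prod.cong) auto
    also have "qfact q (a j) = qnum q (a j) * qfact q (?b j)"
      using j qfact_Suc[of q "a j - 1"] by simp
    also have "qnum q (a j) * qfact q (?b j) * (\<Prod>i\<in>{1..m} - {j}. qfact q (?b i)) =
        qnum q (a j) * (\<Prod>i=1..m. qfact q (?b i))"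
      using j by (subst prod.remove[of "{1..m}" j]) (auto simp: mult.assoc)
    finally have "q ^ ?s j * inv_gf m ?b q * (\<Prod>j=1..m. qfact q (a j)) =
       q ^ ?s j * qnum q (a j) * (inv_gf m ?b q * (\<Prod>i=1..m. qfact q (?b i)))"
      by (simp add: mult_ac)
    also have "\<dots> = q ^ ?s j * qnum q (a j) * qfact q n"
      unfolding Suc(1)[OF n] n[symmetric] ..
    finally show "q ^ ?s j * inv_gf m ?b q * (\<Prod>j=1..m. qfact q (a j)) =
       q ^ ?s j * qnum q (a j) * qfact q n" .
  qed
  also have "\<dots> = (\<Sum>j\<in>?J. q ^ ?s j * qnum q (a j)) * qfact q n"
    by (simp add: sum_distrib_right)
  \<comment> \<open>Letters with \<open>a j = 0\<close> may be added back, since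
    \<open>qnum q 0 = 0\<close>.\<close>
  also have "(\<Sum>j\<in>?J. q ^ ?s j * qnum q (a j)) = (\<Sum>j=1..m. q ^ ?s j * qnum q (a j))"
    by (rule sum.mono_neutral_left) auto
  also have "\<dots> * qfact q n = qfact q (Suc n)"
    unfolding qnum_sum[symmetric] Suc(2)[symmetric] by (rule qfact_Suc[symmetric])
  finally show ?case unfolding Suc(2) .
qed

text \<open>The q-Pascal rule defines the coefficient without division. The truncated
  \<open>n - b\<close> is harmless, since \<open>qbin q n b\<close> is \<open>0\<close> for
  \<open>n < b\<close>.\<close>

fun qbin :: "'a::comm_ring_1 \<Rightarrow> nat \<Rightarrow> nat \<Rightarrow> 'a" where
  "qbin q n 0 = 1"
| "qbin q 0 (Suc b) = 0"
| "qbin q (Suc n) (Suc b) = qbin q n (Suc b) + q ^ (n - b) * qbin q n b"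

lemma qbin_eq_0: "n < b \<Longrightarrow> qbin q n b = 0"
  by (induction q n b rule: qbin.induct) auto

text \<open>The two terms of the q-Pascal rule contribute \<open>qnum q (n - b)\<close> and
  \<open>q ^ (n - b) * qnum q (Suc b)\<close> times \<open>qfact q n\<close>, and
  \<open>qnum_add\<close> merges them into \<open>qnum q (Suc n)\<close>.\<close>

lemma qbin_qfact: "b \<le> n \<Longrightarrow> qbin q n b * qfact q b * qfact q (n - b) = qfact q n"
proof (induction q n b rule: qbin.induct)
  case (3 q n b)
  hence b: "b \<le> n" by simp
  show ?case
  proof (cases "b = n")
    \<comment> \<open>On the diagonal the first term of the recursion is zero, and the induction
      hypothesis is available only for the second.\<close>
    case True
    have "qbin q n n * qfact q n = qfact q n" using 3 b True by simp
    thus ?thesis using True by (simp add: qbin_eq_0 qfact_Suc mult.left_commute[of "qbin q n n"])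
  next
    case False
    with b obtain k where k: "n = Suc (b + k)" by (metis less_natE nat_less_le)
    have 1: "qbin q n (Suc b) * qfact q (Suc b) * qfact q k = qfact q n"
      and 2: "qbin q n b * qfact q b * qfact q (Suc k) = qfact q n"
      using 3 by (simp_all add: k)
    have "qbin q (Suc n) (Suc b) * qfact q (Suc b) * qfact q (Suc k) =
      qnum q (Suc k) * (qbin q n (Suc b) * qfact q (Suc b) * qfact q k)
      + q ^ Suc k * qnum q (Suc b) * (qbin q n b * qfact q b * qfact q (Suc k))"
      by (simp add: qfact_Suc[of q b] qfact_Suc[of q k] k algebra_simps)
    also have "\<dots> = (qnum q (Suc k) + q ^ Suc k * qnum q (Suc b)) * qfact q n"
      unfolding 1 2 by (simp add: algebra_simps)
    also have "qnum q (Suc k) + q ^ Suc k * qnum q (Suc b) = qnum q (Suc n)"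
      using qnum_add[of q "Suc k" "Suc b"] by (simp add: k add.commute)
    finally show ?thesis by (simp add: k qfact_Suc)
  qed
qed simp_all

text \<open>The q-binomial theorem. In the step from \<open>n\<close> to \<open>Suc n\<close>, the
  exponents match because \<open>(Suc b choose 2) + (n - b) = n + (b choose 2)\<close>.\<close>

lemma q_binomial:
  "(\<Prod>j<n. 1 + z * q ^ j) = (\<Sum>b\<le>n. q ^ (b choose 2) * qbin q n b * z ^ b)"
proof (induction n)
  case (Suc n)
  let ?c = "\<lambda>n b. q ^ (b choose 2) * qbin q n b"
  have c: "?c (Suc n) (Suc b) = ?c n (Suc b) + q ^ n * ?c n b" if "b \<le> n" for b
  proof -
    have "?c (Suc n) (Suc b) = ?c n (Suc b) + q ^ ((Suc b choose 2) + (n - b)) * qbin q n b"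
      by (simp add: distrib_left power_add mult.assoc)
    also have "(Suc b choose 2) + (n - b) = n + (b choose 2)"
      using that unfolding numeral_2_eq_2 binomial_Suc_Suc by simp
    finally show ?thesis by (simp add: power_add mult.assoc)
  qed
  have "(\<Sum>b\<le>Suc n. ?c (Suc n) b * z ^ b) = 1 + (\<Sum>b\<le>n. ?c (Suc n) (Suc b) * z ^ Suc b)"
    by (subst sum.atMost_Suc_shift) (simp add: numeral_2_eq_2)
  also have "\<dots> = 1 + (\<Sum>b\<le>n. (?c n (Suc b) + q ^ n * ?c n b) * z ^ Suc b)"
    using c by (intro arg_cong2[where f = plus] sum.cong refl) simp
  also have "\<dots> = (1 + (\<Sum>b\<le>n. ?c n (Suc b) * z ^ Suc b)) + z * q ^ n * (\<Sum>b\<le>n. ?c n b * z ^ b)"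
    by (simp add: algebra_simps sum.distrib sum_distrib_left)
  also have "1 + (\<Sum>b\<le>n. ?c n (Suc b) * z ^ Suc b) = (\<Sum>b\<le>Suc n. ?c n b * z ^ b)"
    by (subst sum.atMost_Suc_shift) (simp add: numeral_2_eq_2)
  also have "\<dots> = (\<Sum>b\<le>n. ?c n b * z ^ b)"
    by (simp add: qbin_eq_0)
  finally show ?case using Suc by (simp add: algebra_simps)
qed (simp add: numeral_2_eq_2)

section \<open>Passing between polynomials and their values\<close>

lemma poly_qnum: "poly (qnum p n) x = qnum (poly p x) n"
  by (simp add: qnum_def poly_sum)

lemma poly_qfact: "poly (qfact p n) x = qfact (poly p x) n"
  by (simp add: qfact_def poly_prod poly_qnum)

lemma poly_qbin: "poly (qbin p n b) x = qbin (poly p x) n b"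
  by (induction p n b rule: qbin.induct) auto

lemma poly_inv_gf: "poly (inv_gf m a p) x = inv_gf m a (poly p x)"
  by (simp add: inv_gf_def poly_sum)

text \<open>The value at \<open>1\<close> is \<open>fact n\<close>, which is nonzero in
  characteristic zero.\<close>

lemma qfact_X_nz: "qfact [:0, 1::'a::{idom,ring_char_0}:] n \<noteq> 0"
proof
  assume "qfact [:0, 1::'a:] n = 0"
  hence "poly (qfact [:0, 1::'a:] n) 1 = 0" by simp
  thus False by (simp add: poly_qfact qfact_one)
qed

text \<open>Both sides are polynomials in \<open>q\<close>, so the q-factorials may be cancelled even where they
  vanish.\<close>

lemma inv_gf_split:
  fixes q :: "'a::{idom,ring_char_0}"
  assumes S: "S \<subseteq> {1..m}"
  shows "inv_gf m a q = qbin q (\<Sum>j=1..m. a j) (\<Sum>j\<in>S. a j)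
    * inv_gf m (\<lambda>j. if j \<in> S then a j else 0) q * inv_gf m (\<lambda>j. if j \<in> S then 0 else a j) q"
proof -
  define X where "X = [:0, 1::'a:]"
  let ?T = "{1..m} - S"
  let ?b = "\<lambda>j. if j \<in> S then a j else 0" and ?c = "\<lambda>j. if j \<in> S then 0 else a j"
  have X: "qfact X n \<noteq> 0" for n unfolding X_def by (rule qfact_X_nz)
  have split: "(\<Sum>j=1..m. f j) = (\<Sum>j\<in>S. f j) + (\<Sum>j\<in>?T. f j)" for f :: "nat \<Rightarrow> nat"
    using sum.subset_diff[OF S, of f] by simp
  have sums: "(\<Sum>j=1..m. a j) = (\<Sum>j\<in>S. a j) + (\<Sum>j\<in>?T. a j)"
    "(\<Sum>j=1..m. ?b j) = (\<Sum>j\<in>S. a j)" "(\<Sum>j=1..m. ?c j) = (\<Sum>j\<in>?T. a j)"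
    unfolding split by (auto intro!: sum.cong)
  have prods: "(\<Prod>j=1..m. qfact X (a j)) = (\<Prod>j=1..m. qfact X (?b j)) * (\<Prod>j=1..m. qfact X (?c j))"
    unfolding prod.distrib[symmetric] by (intro prod.cong) auto
  let ?P = "\<Prod>j=1..m. qfact X (a j)"
  have "inv_gf m a X * ?P = qfact X (\<Sum>j=1..m. a j)"
    by (rule inv_gf_qfact)
  also have "\<dots> = qbin X (\<Sum>j=1..m. a j) (\<Sum>j\<in>S. a j) * qfact X (\<Sum>j=1..m. ?b j) * qfact X (\<Sum>j=1..m. ?c j)"
    using qbin_qfact[of "\<Sum>j\<in>S. a j" "\<Sum>j=1..m. a j" X] unfolding sums by simp
  also have "\<dots> = qbin X (\<Sum>j=1..m. a j) (\<Sum>j\<in>S. a j) * inv_gf m ?b X * inv_gf m ?c X * ?P"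
    unfolding inv_gf_qfact[symmetric] prods by (simp only: mult_ac)
  finally have "inv_gf m a X = qbin X (\<Sum>j=1..m. a j) (\<Sum>j\<in>S. a j) * inv_gf m ?b X * inv_gf m ?c X"
    using X by simp
  hence "poly (inv_gf m a X) q =
      poly (qbin X (\<Sum>j=1..m. a j) (\<Sum>j\<in>S. a j) * inv_gf m ?b X * inv_gf m ?c X) q"
    by simp
  thus ?thesis by (simp add: poly_qbin poly_inv_gf X_def)
qed

section \<open>Bounds for q-binomial coefficients on the unit circle\<close>

text \<open>Concavity of the sine on \<open>{0..pi}\<close>, applied between \<open>0\<close> and
  \<open>x\<close>.\<close>

lemma sin_scale_ge:
  fixes c x :: real
  assumes "0 \<le> c" "c \<le> 1" "0 \<le> x" "x \<le> pi"
  shows "c * sin x \<le> sin (c * x)"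
proof -
  have "convex_on {0..pi} (\<lambda>x. - sin x)"
    by (rule convex_on_realI[where f' = "\<lambda>x. - cos x"])
      (auto intro!: derivative_eq_intros cos_monotone_0_pi_le)
  from convex_onD[OF this, of c 0 x] assms show ?thesis by simp
qed

text \<open>The Dirichlet kernel formula, multiplied out so that no case
  \<open>sin (t / 2) = 0\<close> arises.\<close>

lemma qnum_cis: "qnum (cis t) n * sin (t / 2) = cis ((real n - 1) * t / 2) * sin (real n * t / 2)"
proof (induction n)
  case (Suc n)
  define x y where "x = t / 2" and "y = real n * t / 2"
  have xy: "(real n - 1) * t / 2 = y + - x" "real (Suc n) * t / 2 = y + x"
    "(real (Suc n) - 1) * t / 2 = y" "real n * t = y + y" "real n * t / 2 = y" "t / 2 = x"
    by (simp_all add: x_def y_def field_simps)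
  have "cis (- x) * sin y + cis y * sin x = complex_of_real (sin (y + x))"
    by (simp add: complex_eq_iff sin_add mult_ac)
  hence *: "cis y * (cis (- x) * sin y + cis y * sin x) = cis y * sin (y + x)" by simp
  have "qnum (cis t) (Suc n) * sin x = qnum (cis t) n * sin x + cis y * cis y * sin x"
    by (simp add: qnum_def Complex.DeMoivre xy distrib_right cis_mult)
  also have "\<dots> = cis y * cis (- x) * sin y + cis y * cis y * sin x"
    using Suc unfolding xy by (simp add: cis_mult)
  also have "\<dots> = cis y * sin (y + x)"
    unfolding *[symmetric] by (simp only: distrib_left mult.assoc)
  finally show ?case unfolding xy .
qed simp

text \<open>With \<open>x = \<bar>t\<bar> / 2\<close> the norm is
  \<open>\<bar>sin (n * x)\<bar> / sin x\<close>. If \<open>n * x \<le> pi\<close>, the double angle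
  formula yields the factor \<open>cos (n * x / 2)\<close>, and
  \<open>n * x / 2 \<ge> 1 / 8\<close>. If \<open>n * x > pi\<close>, Jordan's inequality gives
  \<open>n * sin x > 2\<close>, so the quotient is below \<open>n / 2\<close>, which suffices as
  \<open>cos (1 / 8) \<ge> 1 / 2\<close>.\<close>

lemma norm_qnum_cis:
  assumes n: "n \<ge> 2" and t: "1 / (2 * real n) \<le> \<bar>t\<bar>" "\<bar>t\<bar> \<le> pi"
  shows "norm (qnum (cis t) n) \<le> cos (1 / 8) * real n"
proof -
  define x where "x = \<bar>t\<bar> / 2"
  have x: "1 / 4 \<le> real n * x" "x \<le> pi / 2" "0 < x"
    using t n by (auto simp: x_def field_simps)
  hence s: "sin x > 0" by (intro sin_gt_zero) auto
  have c: "1 / 2 \<le> cos (1 / 8 :: real)"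
    using cos_monotone_0_pi_le[of "1/8" "pi/3"] pi_gt3 by (simp add: cos_60)
  have "\<bar>sin (real n * x)\<bar> \<le> cos (1 / 8) * real n * sin x"
  proof (cases "real n * x \<le> pi")
    case True
    \<comment> \<open>The scaling factor \<open>2 / n\<close> is at most \<open>1\<close> because
      \<open>n \<ge> 2\<close>.\<close>
    have "2 / real n * sin (real n * x / 2) \<le> sin (2 / real n * (real n * x / 2))"
      using n x True by (intro sin_scale_ge) (auto simp: field_simps)
    hence 1: "2 * sin (real n * x / 2) \<le> real n * sin x"
      using n by (simp add: field_simps)
    have 2: "cos (real n * x / 2) \<le> cos (1 / 8)"
      using True x by (intro cos_monotone_0_pi_le) auto
    have 3: "0 \<le> cos (real n * x / 2)" "0 \<le> sin (real n * x / 2)"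
      using True x by (auto intro!: cos_ge_zero sin_ge_zero)
    have "\<bar>sin (real n * x)\<bar> = \<bar>2 * sin (real n * x / 2) * cos (real n * x / 2)\<bar>"
      using sin_double[of "real n * x / 2"] by simp
    also have "\<dots> = 2 * sin (real n * x / 2) * cos (real n * x / 2)"
      using 3 by (simp add: abs_mult)
    also have "\<dots> \<le> (real n * sin x) * cos (1 / 8)"
      using s by (intro mult_mono 1 2 3) simp_all
    finally show ?thesis by (simp add: mult_ac)
  next
    case False
    have "2 * x / pi * sin (pi / 2) \<le> sin (2 * x / pi * (pi / 2))"
      using x by (intro sin_scale_ge) (auto simp: field_simps)
    hence "2 * x / pi \<le> sin x" by simp
    hence "real n * (2 * x / pi) \<le> real n * sin x" by (intro mult_left_mono) auto
    moreover have "2 < real n * (2 * x / pi)" using False by (simp add: field_simps)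
    ultimately have "2 \<le> real n * sin x" by linarith
    hence "1 / 2 * 2 \<le> cos (1 / 8) * (real n * sin x)"
      using c by (intro mult_mono) auto
    moreover have "\<bar>sin (real n * x)\<bar> \<le> 1" by (rule abs_sin_le_one)
    ultimately show ?thesis unfolding mult.assoc by linarith
  qed
  moreover have "norm (qnum (cis t) n) * sin x = \<bar>sin (real n * x)\<bar>"
  proof -
    have "norm (qnum (cis t) n * sin (t / 2)) = \<bar>sin (real n * t / 2)\<bar>"
      unfolding qnum_cis by (simp add: norm_mult)
    hence "norm (qnum (cis t) n) * \<bar>sin (t / 2)\<bar> = \<bar>sin (real n * t / 2)\<bar>"
      by (simp add: norm_mult)
    thus ?thesis
      using s by (cases "t \<ge> 0") (auto simp: x_def)
  qed
  ultimately have "norm (qnum (cis t) n) * sin x \<le> cos (1 / 8) * real n * sin x" by simp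
  thus ?thesis using s by simp
qed

text \<open>The squared norm is \<open>(1 + r)\<^sup>2 - 2 * r * (1 - cos x)\<close>; after
  factoring out \<open>(1 + r)\<^sup>2\<close>, the inequality \<open>1 + y \<le> exp y\<close>
  applies.\<close>

lemma norm_one_plus_rcis:
  assumes r: "r \<ge> 0"
  shows "norm (1 + rcis r x) \<le> (1 + r) * exp (- (r / (1 + r)\<^sup>2 * (1 - cos x)))"
proof (rule power2_le_imp_le)
  let ?u = "r / (1 + r)\<^sup>2 * (1 - cos x)"
  have "(norm (1 + rcis r x))\<^sup>2 = (1 + r * cos x)\<^sup>2 + (r * sin x)\<^sup>2"
    by (simp add: cmod_power2 rcis_def)
  also have "\<dots> = 1 + 2 * r * cos x + r\<^sup>2 * ((cos x)\<^sup>2 + (sin x)\<^sup>2)"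
    by algebra
  also have "\<dots> = (1 + r)\<^sup>2 - 2 * r * (1 - cos x)"
    unfolding sin_cos_squared_add2 by (simp add: power2_eq_square algebra_simps)
  also have "\<dots> = (1 + r)\<^sup>2 * (1 + - (2 * ?u))"
    using r by (simp add: field_simps)
  also have "\<dots> \<le> (1 + r)\<^sup>2 * exp (- (2 * ?u))"
    by (intro mult_left_mono exp_ge_add_one_self) auto
  also have "\<dots> = ((1 + r) * exp (- ?u))\<^sup>2"
    by (simp add: power_mult_distrib flip: exp_double)
  finally show "(norm (1 + rcis r x))\<^sup>2 \<le> ((1 + r) * exp (- ?u))\<^sup>2" .
qed (use r in auto)

text \<open>The cosines of the arguments sum to the real part of a rotated
  \<open>qnum (cis t) n\<close>, so the total gain is bounded below independently of the phase
  \<open>x\<close>.\<close>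

lemma norm_prod_one_plus_le:
  assumes r: "r \<ge> 0"
  shows "norm (\<Prod>j<n. 1 + rcis r x * cis t ^ j) \<le>
    (1 + r) ^ n * exp (- (r / (1 + r)\<^sup>2 * (real n - norm (qnum (cis t) n))))"
proof -
  let ?u = "r / (1 + r)\<^sup>2"
  have e: "rcis r x * cis t ^ j = rcis r (x + real j * t)" for j
    by (simp add: rcis_def Complex.DeMoivre cis_mult)
  have "norm (\<Prod>j<n. 1 + rcis r x * cis t ^ j) \<le>
      (\<Prod>j<n. (1 + r) * exp (- (?u * (1 - cos (x + real j * t)))))"
    unfolding e prod_norm[symmetric] using r
    by (intro prod_mono conjI norm_ge_zero norm_one_plus_rcis)
  also have "\<dots> = (1 + r) ^ n * exp (- (?u * (\<Sum>j<n. 1 - cos (x + real j * t))))"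
    by (simp add: prod.distrib exp_sum sum_distrib_left sum_negf[symmetric] del: sum_negf)
  also have "\<dots> \<le> (1 + r) ^ n * exp (- (?u * (real n - norm (qnum (cis t) n))))"
  proof -
    have "(\<Sum>j<n. cos (x + real j * t)) = Re (cis x * qnum (cis t) n)"
      by (simp add: qnum_def sum_distrib_left Complex.DeMoivre cis_mult)
    also have "\<dots> \<le> norm (cis x * qnum (cis t) n)" by (rule complex_Re_le_cmod)
    also have "\<dots> = norm (qnum (cis t) n)" by (simp add: norm_mult)
    finally have "real n - norm (qnum (cis t) n) \<le> (\<Sum>j<n. 1 - cos (x + real j * t))"
      by (simp add: sum_subtractf)
    thus ?thesis using r by (intro mult_left_mono) (auto intro!: mult_left_mono divide_right_mono)
  qed
  finally show ?thesis .
qed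

section \<open>Fourier coefficients and the Cauchy estimate\<close>

lemma has_integral_cis:
  fixes k :: int
  shows "has_bochner_integral lborel (\<lambda>t. indicator {-pi..pi} t *\<^sub>R cis (of_int k * t))
    (if k = 0 then 2 * pi else 0)"
proof (cases "k = 0")
  case True
  have "has_bochner_integral lborel (\<lambda>t. indicator {-pi..pi} t *\<^sub>R (1::complex))
     (complex_of_real pi - complex_of_real (-pi))"
    by (rule has_bochner_integral_FTC_Icc)
      (auto intro!: derivative_eq_intros continuous_intros simp: has_vector_derivative_def scaleR_conv_of_real)
  thus ?thesis using True by simp
next
  case False
  let ?F = "\<lambda>t. cis (of_int k * t) / (\<i> * of_int k)"
  have "has_bochner_integral lborel (\<lambda>t. indicator {-pi..pi} t *\<^sub>R cis (of_int k * t)) (?F pi - ?F (-pi))"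
  proof (rule has_bochner_integral_FTC_Icc)
    fix x :: real
    have "((\<lambda>t. exp (\<i> * of_int k * of_real t) / (\<i> * of_int k)) has_vector_derivative
            exp (\<i> * of_int k * of_real x)) (at x within {-pi..pi})"
      using False
      by (auto intro!: derivative_eq_intros has_vector_derivative_real_field[where f = "\<lambda>z. exp (\<i> * of_int k * z) / (\<i> * of_int k)"])
    thus "(?F has_vector_derivative cis (of_int k * x)) (at x within {-pi..pi})"
      by (simp add: cis_conv_exp mult_ac)
  qed (auto intro!: continuous_intros)
  moreover have "?F pi = ?F (-pi)"
  proof -
    have "cis (of_int k * pi) = cis (of_int k * -pi) * cis (2 * pi * of_int k)"
      unfolding cis_mult by (simp add: algebra_simps)
    thus ?thesis by simp
  qed
  ultimately show ?thesis using False by simp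
qed

text \<open>Exponents may repeat over the index set, so the lemma serves both for coefficients of a
  polynomial and for sums over words.\<close>

lemma fourier_coeff:
  fixes c :: "'i \<Rightarrow> complex" and f :: "'i \<Rightarrow> nat" and k :: int
  shows "has_bochner_integral lborel
    (\<lambda>t. indicator {-pi..pi} t *\<^sub>R ((\<Sum>i\<in>A. c i * cis t ^ f i) * cis (- (of_int k * t))))
    (2 * pi * (\<Sum>i\<in>A. if int (f i) = k then c i else 0))"
proof -
  have "has_bochner_integral lborel
      (\<lambda>t. \<Sum>i\<in>A. c i * (indicator {-pi..pi} t *\<^sub>R cis (of_int (int (f i) - k) * t)))
      (\<Sum>i\<in>A. c i * (if int (f i) - k = 0 then 2 * pi else 0))"
    by (intro has_bochner_integral_sum has_bochner_integral_mult_right has_integral_cis)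
  also have "(\<lambda>t. \<Sum>i\<in>A. c i * (indicator {-pi..pi} t *\<^sub>R cis (of_int (int (f i) - k) * t))) =
    (\<lambda>t. indicator {-pi..pi} t *\<^sub>R ((\<Sum>i\<in>A. c i * cis t ^ f i) * cis (- (of_int k * t))))"
    by (intro ext)
      (simp add: sum_distrib_right scaleR_sum_right Complex.DeMoivre mult.assoc cis_mult left_diff_distrib)
  also have "(\<Sum>i\<in>A. c i * (if int (f i) - k = 0 then 2 * pi else 0)) =
     2 * pi * (\<Sum>i\<in>A. if int (f i) = k then c i else 0)"
    unfolding sum_distrib_left by (intro sum.cong) auto
  finally show ?thesis .
qed

text \<open>Cauchy's estimate on the circle of radius \<open>r\<close>: the coefficient is a mean
  over the circle, and a mean is at most the supremum \<open>B\<close>.\<close>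

lemma coeff_norm_le:
  fixes c :: "nat \<Rightarrow> complex"
  assumes r: "r \<ge> 0" and b: "b \<le> n"
    and B: "\<And>x. norm (\<Sum>k\<le>n. c k * rcis r x ^ k) \<le> B"
  shows "norm (c b) * r ^ b \<le> B"
proof -
  let ?g = "\<lambda>t. (\<Sum>k\<le>n. c k * of_real r ^ k * cis t ^ k) * cis (- (of_int (int b) * t))"
  have g: "norm (?g t) \<le> B" for t
    using B[of t] by (simp add: norm_mult rcis_def power_mult_distrib mult.assoc)
  have i: "has_bochner_integral lborel (\<lambda>t. indicator {-pi..pi} t *\<^sub>R ?g t) (2 * pi * (c b * of_real r ^ b))"
    using fourier_coeff[where A = "{..n}" and c = "\<lambda>k. c k * of_real r ^ k" and f = "\<lambda>k. k" and k = "int b"] b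
    by simp
  have i': "has_bochner_integral lborel (\<lambda>t. B * indicator {-pi..pi} t) (B * (2 * pi))"
    using has_bochner_integral_real_indicator[of "{-pi..pi}" lborel]
    by (intro has_bochner_integral_mult_right) auto
  have "norm (LINT t|lborel. indicator {-pi..pi} t *\<^sub>R ?g t) \<le> (LINT t|lborel. B * indicator {-pi..pi} t)"
  proof (rule Bochner_Integration.integral_norm_bound_integral)
    show "integrable lborel (\<lambda>t. indicator {-pi..pi} t *\<^sub>R ?g t)"
      using i by (rule integrable.intros)
    show "integrable lborel (\<lambda>t. B * indicator {-pi..pi} t)"
      using i' by (rule integrable.intros)
  qed (use g in \<open>auto split: split_indicator\<close>)
  hence "norm (2 * pi * (c b * of_real r ^ b)) \<le> B * (2 * pi)"
    unfolding has_bochner_integral_integral_eq[OF i] has_bochner_integral_integral_eq[OF i'] .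
  thus ?thesis using r by (simp add: norm_mult norm_power)
qed

section \<open>The saddle point radius for q-binomial coefficients\<close>

lemma unimodal_le:
  fixes f :: "nat \<Rightarrow> real"
  assumes "\<And>k. k < b \<Longrightarrow> f k \<le> f (Suc k)" "\<And>k. k \<ge> b \<Longrightarrow> f (Suc k) \<le> f k"
  shows "f k \<le> f b"
proof (cases "k \<le> b")
  case True
  thus ?thesis
    by (induction rule: inc_induct) (use assms(1) in \<open>auto intro: order_trans\<close>)
next
  case False
  hence "b \<le> k" by simp
  thus ?thesis
    by (induction rule: dec_induct) (use assms(2) in \<open>auto intro: order_trans\<close>)
qed

text \<open>The ratio \<open>r\<close> is chosen so that the terms of the expansion of
  \<open>(1 + r) ^ n\<close> peak at index \<open>b\<close>. The largest of \<open>n + 1\<close>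
  terms is at least their average.\<close>

lemma binomial_mode:
  assumes b: "0 < b" "b < n"
  defines "r \<equiv> real b / real (n - b)"
  shows "(1 + r) ^ n \<le> real (n + 1) * (real (n choose b) * r ^ b)"
proof -
  define f where "f k = real (n choose k) * r ^ k" for k
  have r: "r > 0" using b by (simp add: r_def)
  have step: "real (Suc k) * f (Suc k) = real (n - k) * r * f k" for k
  proof -
    have "Suc k * (n choose Suc k) = (n - k) * (n choose k)"
      by (metis binomial_absorb_comp binomial_absorption)
    hence "real (Suc k) * real (n choose Suc k) = real (n - k) * real (n choose k)"
      by (metis of_nat_mult)
    thus ?thesis by (simp add: f_def)
  qed
  have f: "f k \<ge> 0" for k using r by (simp add: f_def)
  have le: "f k \<le> f b" for k
  proof (rule unimodal_le)
    fix k assume k: "k < b"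
    have "real n * real (Suc k) \<le> real n * real b" using k by (intro mult_left_mono) auto
    hence "real (Suc k) \<le> real (n - k) * r"
      using k b by (simp add: r_def field_simps of_nat_diff)
    hence "real (Suc k) * f k \<le> real (Suc k) * f (Suc k)"
      unfolding step by (intro mult_right_mono f)
    thus "f k \<le> f (Suc k)" by simp
  next
    fix k assume k: "k \<ge> b"
    show "f (Suc k) \<le> f k"
    proof (cases "k < n")
      case True
      have "real b + real b * real n \<le> real n + real k * real n"
        using k b by (intro add_mono mult_right_mono) auto
      hence "real (n - k) * r \<le> real (Suc k)"
        using True k b by (simp add: r_def field_simps of_nat_diff)
      hence "real (Suc k) * f (Suc k) \<le> real (Suc k) * f k"
        unfolding step by (intro mult_right_mono f)
      thus ?thesis by simp
    next
      case False
      thus ?thesis using f[of k] by (simp add: f_def binomial_eq_0)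
    qed
  qed
  have "(1 + r) ^ n = (\<Sum>k\<le>n. f k)"
    using binomial_ring[of r 1 n] by (simp add: f_def add.commute)
  also have "\<dots> \<le> (\<Sum>k\<le>n. f b)" by (intro sum_mono le)
  finally show ?thesis by (simp add: f_def)
qed

text \<open>Cauchy's estimate for the product in \<open>q_binomial\<close>, at radius
  \<open>r = b / (n - b)\<close>. By \<open>binomial_mode\<close> this radius costs only the factor
  \<open>n + 1\<close> over the value at \<open>q = 1\<close>, and the gain in the exponent is
  proportional to \<open>r / (1 + r)\<^sup>2 * n = b * (n - b) / n\<close>.\<close>

lemma norm_qbin_cis:
  assumes b: "0 < b" "b < n" and t: "1 / (2 * real n) \<le> \<bar>t\<bar>" "\<bar>t\<bar> \<le> pi"
  shows "norm (qbin (cis t) n b) \<le>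
    real (n + 1) * real (n choose b) * exp (- ((1 - cos (1 / 8)) * (real b * real (n - b) / real n)))"
proof -
  define r where "r = real b / real (n - b)"
  define B where "B = (1 + r) ^ n * exp (- (r / (1 + r)\<^sup>2 * (real n - cos (1 / 8) * real n)))"
  have r: "r > 0" using b by (simp add: r_def)
  have "norm (cis t ^ (b choose 2) * qbin (cis t) n b) * r ^ b \<le> B"
  proof (rule coeff_norm_le)
    fix x
    have "norm (\<Sum>k\<le>n. cis t ^ (k choose 2) * qbin (cis t) n k * rcis r x ^ k) =
        norm (\<Prod>j<n. 1 + rcis r x * cis t ^ j)"
      by (simp only: q_binomial)
    also have "\<dots> \<le> (1 + r) ^ n * exp (- (r / (1 + r)\<^sup>2 * (real n - norm (qnum (cis t) n))))"
      using r by (intro norm_prod_one_plus_le) auto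
    also have "\<dots> \<le> B"
      unfolding B_def using r b t norm_qnum_cis[of n t]
      by (intro mult_left_mono) (auto intro!: mult_left_mono divide_right_mono)
    finally show "norm (\<Sum>k\<le>n. cis t ^ (k choose 2) * qbin (cis t) n k * rcis r x ^ k) \<le> B" .
  qed (use r b in auto)
  hence "norm (qbin (cis t) n b) * r ^ b \<le> B" by (simp add: norm_mult norm_power)
  also have "r / (1 + r)\<^sup>2 * (real n - cos (1 / 8) * real n) =
      (1 - cos (1 / 8)) * (real b * real (n - b) / real n)"
  proof -
    have "1 + r = real n / real (n - b)" using b by (simp add: r_def field_simps of_nat_diff)
    hence "r / (1 + r)\<^sup>2 * real n = real b * real (n - b) / real n"
      using b by (simp add: r_def power2_eq_square field_simps del: of_nat_diff)
    moreover have "u * (real n - cos (1 / 8) * real n) = (1 - cos (1 / 8)) * (u * real n)" for u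
      by (simp add: algebra_simps)
    ultimately show ?thesis by metis
  qed
  hence "B = (1 + r) ^ n * exp (- ((1 - cos (1 / 8)) * (real b * real (n - b) / real n)))"
    by (simp add: B_def)
  also have "\<dots> \<le> real (n + 1) * (real (n choose b) * r ^ b) *
      exp (- ((1 - cos (1 / 8)) * (real b * real (n - b) / real n)))"
    unfolding r_def using binomial_mode[OF b] by (intro mult_right_mono) auto
  finally have "norm (qbin (cis t) n b) * r ^ b \<le> real (n + 1) * real (n choose b) *
      exp (- ((1 - cos (1 / 8)) * (real b * real (n - b) / real n))) * r ^ b"
    by (simp add: mult_ac)
  thus ?thesis using r by simp
qed

section \<open>The characteristic function of the number of inversions\<close>

text \<open>If one letter makes up at least a third of the word, the most frequent letter alone is
  one class, with \<open>Abar m a\<close> positions outside. Otherwise the shortest initial segment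
  of letters reaching a third of the total overshoots by less than another third, so its complement
  also has a third.\<close>

lemma balanced_subset:
  fixes a :: "nat \<Rightarrow> nat" and m :: nat
  assumes m: "m \<ge> 1"
  obtains S where "S \<subseteq> {1..m}" "Abar m a \<le> 3 * (\<Sum>j\<in>S. a j)"
    "Abar m a \<le> 3 * ((\<Sum>j=1..m. a j) - (\<Sum>j\<in>S. a j))"
proof -
  let ?N = "\<Sum>j=1..m. a j" and ?M = "Max (a ` {1..m})"
  have "?M \<in> a ` {1..m}" using m by (intro Max_in) auto
  then obtain i where i: "i \<in> {1..m}" "a i = ?M" by auto
  have M: "a j \<le> ?M" if "j \<in> {1..m}" for j using that by (intro Max_ge) auto
  show ?thesis
  proof (cases "?N \<le> 3 * ?M")
    case True
    show ?thesis
      using i True by (intro that[of "{i}"]) (auto simp: Abar_def)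
  next
    case False
    define l where "l = (LEAST l. ?N \<le> 3 * (\<Sum>j=1..l. a j))"
    have l: "?N \<le> 3 * (\<Sum>j=1..l. a j)" unfolding l_def by (rule LeastI[of _ m]) simp
    have lm: "l \<le> m" unfolding l_def by (rule Least_le) simp
    have "3 * (\<Sum>j=1..l. a j) \<le> 2 * ?N"
    proof (cases l)
      case (Suc k)
      have "\<not> ?N \<le> 3 * (\<Sum>j=1..k. a j)"
        using Suc unfolding l_def by (intro not_less_Least) simp
      moreover have "a l \<le> ?M" using Suc lm by (intro M) auto
      ultimately show ?thesis using False Suc by simp
    qed simp
    with l lm show ?thesis
      by (intro that[of "{1..l}"]) (auto simp: Abar_def)
  qed
qed

lemma qbin_one: "qbin 1 n b = of_nat (n choose b)"
  by (induction "1::'a" n b rule: qbin.induct) auto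

lemma inv_gf_one: "inv_gf m a 1 = of_nat (card (words m a))"
  by (simp add: inv_gf_def)

lemma norm_inv_gf_cis_le: "norm (inv_gf m a (cis t)) \<le> real (card (words m a))"
  unfolding inv_gf_def by (rule order_trans[OF norm_sum]) (simp add: norm_power)

text \<open>\<open>inv_gf_split\<close> is used at \<open>cis t\<close> and at \<open>1\<close>: the
  two inner factors are bounded by their values at \<open>1\<close>, and only the q-binomial
  coefficient supplies decay. Of \<open>b\<close> and \<open>N - b\<close>, one is at least
  \<open>N / 2\<close> and the other at least \<open>Abar m a / 3\<close>, so
  \<open>b * (N - b) / N \<ge> Abar m a / 6\<close>.\<close>

lemma norm_inv_gf_decay:
  fixes a :: "nat \<Rightarrow> nat" and m :: nat
  defines "N \<equiv> \<Sum>j=1..m. a j"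
  assumes m: "m \<ge> 1" and A: "Abar m a > 0" and t: "1 / (2 * real N) \<le> \<bar>t\<bar>" "\<bar>t\<bar> \<le> pi"
  shows "norm (inv_gf m a (cis t)) \<le>
    real (card (words m a)) * (real (N + 1) * exp (- ((1 - cos (1 / 8)) / 6 * real (Abar m a))))"
proof -
  obtain S where S: "S \<subseteq> {1..m}" "Abar m a \<le> 3 * (\<Sum>j\<in>S. a j)" "Abar m a \<le> 3 * (N - (\<Sum>j\<in>S. a j))"
    using balanced_subset[OF m, of a] unfolding N_def by metis
  define b where "b = (\<Sum>j\<in>S. a j)"
  let ?W1 = "inv_gf m (\<lambda>j. if j \<in> S then a j else 0) :: complex \<Rightarrow> complex"
  let ?W2 = "inv_gf m (\<lambda>j. if j \<in> S then 0 else a j) :: complex \<Rightarrow> complex"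
  let ?e = "exp (- ((1 - cos (1 / 8)) / 6 * real (Abar m a)))"
  have b: "0 < b" "b < N" "Abar m a \<le> 3 * b" "Abar m a \<le> 3 * (N - b)"
    using S A by (auto simp: b_def)
  have split: "inv_gf m a q = qbin q N b * ?W1 q * ?W2 q" for q
    unfolding N_def b_def by (rule inv_gf_split[OF S(1)])
  have W: "norm (?W1 (cis t)) \<le> norm (?W1 1)" "norm (?W2 (cis t)) \<le> norm (?W2 1)"
    unfolding inv_gf_one norm_of_nat by (rule norm_inv_gf_cis_le)+
  have bound: "real (Abar m a) / 6 \<le> real b * real (N - b) / real N"
  proof -
    have "real (Abar m a) * real N \<le> 6 * (real b * real (N - b))"
    proof (cases "N \<le> 2 * b")
      case True
      hence "real (Abar m a) * real N \<le> real (3 * (N - b)) * real (2 * b)"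
        using b by (intro mult_mono) (auto simp del: of_nat_mult)
      thus ?thesis by (simp add: mult_ac)
    next
      case False
      hence "real (Abar m a) * real N \<le> real (3 * b) * real (2 * (N - b))"
        using b by (intro mult_mono) (auto simp del: of_nat_mult)
      thus ?thesis by (simp add: mult_ac)
    qed
    thus ?thesis using b by (simp add: field_simps)
  qed
  have "norm (qbin (cis t) N b) \<le> real (N + 1) * real (N choose b) *
      exp (- ((1 - cos (1 / 8)) * (real b * real (N - b) / real N)))"
    by (rule norm_qbin_cis) (use b t in auto)
  also have "\<dots> \<le> real (N + 1) * real (N choose b) * exp (- ((1 - cos (1 / 8)) * (real (Abar m a) / 6)))"
    by (intro mult_left_mono iffD2[OF exp_le_cancel_iff] le_imp_neg_le bound) auto
  also have "\<dots> = norm (qbin (1::complex) N b) * (real (N + 1) * ?e)"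
    by (simp add: qbin_one)
  finally have "norm (inv_gf m a (cis t)) \<le>
      (norm (qbin (1::complex) N b) * (real (N + 1) * ?e)) * norm (?W1 1) * norm (?W2 1)"
    unfolding split norm_mult by (intro mult_mono W) auto
  also have "\<dots> = norm (inv_gf m a (1::complex)) * (real (N + 1) * ?e)"
    unfolding split norm_mult by (simp only: mult_ac)
  finally show ?thesis unfolding inv_gf_one norm_of_nat .
qed

text \<open>If \<open>g j\<close> is the logarithm of the \<open>j\<close>-th factor of a factorial, then this is the logarithm of the
  resulting multinomial coefficient.\<close>

definition fact_diff :: "nat \<Rightarrow> (nat \<Rightarrow> nat) \<Rightarrow> (nat \<Rightarrow> real) \<Rightarrow> real" where
  "fact_diff m a g = (\<Sum>j=1..(\<Sum>i=1..m. a i). g j) - (\<Sum>i=1..m. \<Sum>j=1..a i. g j)"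

lemma fact_diff_add: "fact_diff m a (\<lambda>j. f j + g j) = fact_diff m a f + fact_diff m a g"
  by (simp add: fact_diff_def sum.distrib)

lemma fact_diff_cmult: "fact_diff m a (\<lambda>j. c * f j) = c * fact_diff m a f"
  by (simp add: fact_diff_def sum_distrib_left right_diff_distrib)

lemma fact_diff_const: "fact_diff m a (\<lambda>_. c) = 0"
  by (simp add: fact_diff_def sum_distrib_right)

section \<open>The order of the variance\<close>

lemma sum_squares_real: "(\<Sum>j=1..n. (real j)\<^sup>2) = real n ^ 3 / 3 + (real n)\<^sup>2 / 2 + real n / 6"
  by (induction n) (simp_all add: field_simps power2_eq_square power3_eq_cube)

lemma psum_one: "psum m a 1 = real (\<Sum>j=1..m. a j)"
  by (simp add: psum_def)

lemma psum_le_power: "psum m a (Suc k) \<le> psum m a 1 ^ Suc k"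
proof -
  have "real (a j) \<le> psum m a 1" if "j \<in> {1..m}" for j
    unfolding psum_one of_nat_le_iff using that by (intro member_le_sum) auto
  hence "psum m a (Suc k) \<le> (\<Sum>j=1..m. real (a j) * psum m a 1 ^ k)"
    unfolding psum_def[of m a "Suc k"] power_Suc
    by (intro sum_mono mult_left_mono power_mono) auto
  also have "\<dots> = psum m a 1 ^ Suc k"
    by (simp add: psum_def sum_distrib_right)
  finally show ?thesis .
qed

lemma sigma_inv_sq_psum:
  "12 * (sigma_inv m a)\<^sup>2 = (psum m a 1 ^ 3 - psum m a 3) / 3 + ((psum m a 1)\<^sup>2 - psum m a 2) / 2"
  and sigma_inv_nonneg: "0 \<le> sigma_inv m a"
proof -
  define v where "v = (psum m a 1 ^ 3 - psum m a 3) / 3 + ((psum m a 1)\<^sup>2 - psum m a 2) / 2"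
  have "(esym m a 1 + 1) * esym m a 2 - esym m a 3 = v"
    unfolding esym_psum v_def by (simp add: field_simps power2_eq_square power3_eq_cube)
  moreover have "psum m a 3 \<le> psum m a 1 ^ 3" "psum m a 2 \<le> (psum m a 1)\<^sup>2"
    using psum_le_power[of m a 2] psum_le_power[of m a 1] by (simp_all add: numeral_2_eq_2 numeral_3_eq_3)
  hence "0 \<le> v" by (simp add: v_def)
  ultimately have "12 * (sigma_inv m a)\<^sup>2 = v" "0 \<le> sigma_inv m a"
    unfolding sigma_inv_def by simp_all
  thus "12 * (sigma_inv m a)\<^sup>2 = (psum m a 1 ^ 3 - psum m a 3) / 3 + ((psum m a 1)\<^sup>2 - psum m a 2) / 2"
    "0 \<le> sigma_inv m a"
    by (simp_all only: v_def)
qed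

text \<open>The linear terms of the sums of squares cancel. Hence the quadratic term of the
  logarithm of the characteristic function has exactly the variance as its coefficient.\<close>

lemma fact_diff_squares: "fact_diff m a (\<lambda>j. (real j)\<^sup>2) = 12 * (sigma_inv m a)\<^sup>2"
  unfolding fact_diff_def sum_squares_real sum.distrib sigma_inv_sq_psum psum_one[symmetric]
  by (simp add: psum_def field_simps flip: sum_divide_distrib)

text \<open>The summands of the largest \<open>a i\<close> cancel, and \<open>Abar m a\<close> summands remain on either side.\<close>

lemma fact_diff_bound:
  assumes m: "m \<ge> 1" and B: "\<And>j. 1 \<le> j \<Longrightarrow> j \<le> (\<Sum>i=1..m. a i) \<Longrightarrow> \<bar>g j\<bar> \<le> B"
  shows "\<bar>fact_diff m a g\<bar> \<le> 2 * real (Abar m a) * B"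
proof -
  let ?N = "\<Sum>j=1..m. a j" and ?M = "Max (a ` {1..m})"
  have "?M \<in> a ` {1..m}" using m by (intro Max_in) auto
  then obtain i where i: "i \<in> {1..m}" "a i = ?M" by auto
  have N: "?N = a i + (\<Sum>j\<in>{1..m} - {i}. a j)" using i by (intro sum.remove) auto
  hence A: "Abar m a = (\<Sum>j\<in>{1..m} - {i}. a j)" "?N = a i + Abar m a"
    using i by (auto simp: Abar_def)
  have le: "a j \<le> ?N" if "j \<in> {1..m}" for j
    using that by (intro member_le_sum) auto
  have "{1..?N} = {1..a i} \<union> {a i<..?N}" using le[OF i(1)] by auto
  hence "(\<Sum>j=1..?N. g j) = (\<Sum>j\<in>{1..a i} \<union> {a i<..?N}. g j)" by (rule arg_cong)
  also have "\<dots> = (\<Sum>j=1..a i. g j) + (\<Sum>j\<in>{a i<..?N}. g j)"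
    by (rule sum.union_disjoint) auto
  finally have "(\<Sum>j=1..?N. g j) = (\<Sum>j=1..a i. g j) + (\<Sum>j\<in>{a i<..?N}. g j)" .
  moreover have "(\<Sum>k=1..m. \<Sum>j=1..a k. g j) =
      (\<Sum>j=1..a i. g j) + (\<Sum>k\<in>{1..m} - {i}. \<Sum>j=1..a k. g j)"
    using i by (intro sum.remove) auto
  ultimately have "fact_diff m a g = (\<Sum>j\<in>{a i<..?N}. g j) - (\<Sum>k\<in>{1..m} - {i}. \<Sum>j=1..a k. g j)"
    by (simp add: fact_diff_def)
  also have "\<bar>\<dots>\<bar> \<le> \<bar>\<Sum>j\<in>{a i<..?N}. g j\<bar> + \<bar>\<Sum>k\<in>{1..m} - {i}. \<Sum>j=1..a k. g j\<bar>"
    by (rule abs_triangle_ineq4)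
  also have "\<bar>\<Sum>j\<in>{a i<..?N}. g j\<bar> \<le> (\<Sum>j\<in>{a i<..?N}. B)"
    by (intro order_trans[OF sum_abs] sum_mono B) auto
  also have "\<dots> = real (Abar m a) * B"
    using A(2) by simp
  also have "\<bar>\<Sum>k\<in>{1..m} - {i}. \<Sum>j=1..a k. g j\<bar> \<le> (\<Sum>k\<in>{1..m} - {i}. \<Sum>j=1..a k. B)"
    by (intro order_trans[OF sum_abs] sum_mono B) (use le in \<open>auto intro: order_trans\<close>)
  also have "\<dots> = real (Abar m a) * B"
    by (simp add: A(1) sum_distrib_right)
  finally show ?thesis by (simp add: mult_ac)
qed

text \<open>With \<open>M = p - A\<close> the largest multiplicity, the power sums satisfy
  \<open>M ^ k \<le> psum m a k \<le> p * M ^ (k - 1)\<close> for positive \<open>k\<close>.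
  Inserting this into \<open>sigma_inv_sq_psum\<close> leaves multiples of
  \<open>p\<^sup>2 * A\<close>; for the lower bound the cubic part alone suffices.\<close>

lemma sigma_inv_bounds:
  fixes a :: "nat \<Rightarrow> nat" and m :: nat
  defines "N \<equiv> \<Sum>j=1..m. a j"
  assumes m: "m \<ge> 1" and N: "N \<ge> 1"
  shows "(real N)\<^sup>2 * real (Abar m a) / 36 \<le> (sigma_inv m a)\<^sup>2"
    and "(sigma_inv m a)\<^sup>2 \<le> (real N)\<^sup>2 * real (Abar m a) / 6"
proof -
  define M where "M = Max (a ` {1..m})"
  define p q r A where "p = psum m a 1" and "q = psum m a 2" and "r = psum m a 3"
    and "A = real (Abar m a)"
  have "M \<in> a ` {1..m}" using m unfolding M_def by (intro Max_in) auto
  then obtain i where i: "i \<in> {1..m}" "a i = M" by auto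
  have M: "a j \<le> M" if "j \<in> {1..m}" for j using that unfolding M_def by (intro Max_ge) auto
  have p: "p = real N" unfolding p_def psum_one N_def ..
  have "M \<le> N" unfolding N_def i(2)[symmetric] using i(1) by (intro member_le_sum) auto
  moreover have "Abar m a = N - M" by (simp only: Abar_def N_def M_def)
  ultimately have A: "real M = p - A" "0 \<le> A" "A \<le> p" "1 \<le> p"
    using N by (auto simp: A_def p)
  have up: "psum m a (Suc k) \<le> p * real M ^ k" for k
    unfolding p_def psum_def sum_distrib_right using M
    by (intro sum_mono) (auto intro!: mult_left_mono power_mono)
  have lo: "real M ^ k \<le> psum m a k" for k
    unfolding psum_def i(2)[symmetric] using i(1) by (intro member_le_sum) auto
  have q: "(p - A)\<^sup>2 \<le> q" "q \<le> p * (p - A)"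
    using up[of 1] lo[of 2] unfolding A q_def by (simp_all add: numeral_2_eq_2)
  have r: "(p - A) ^ 3 \<le> r" "r \<le> p * (p - A)\<^sup>2"
    using up[of 2] lo[of 3] unfolding A r_def by (simp_all add: numeral_2_eq_2 numeral_3_eq_3)
  have s: "12 * (sigma_inv m a)\<^sup>2 = (p ^ 3 - r) / 3 + (p\<^sup>2 - q) / 2"
    unfolding p_def q_def r_def by (rule sigma_inv_sq_psum)
  have "p\<^sup>2 * A = p * (p * A)" by (simp add: power2_eq_square)
  also have "\<dots> \<le> p * (2 * p * A - A\<^sup>2)"
    using A by (intro mult_left_mono) (auto simp: power2_eq_square algebra_simps mult_left_mono)
  also have "\<dots> = p ^ 3 - p * (p - A)\<^sup>2"
    by (simp add: power2_eq_square power3_eq_cube algebra_simps)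
  finally have 1: "p\<^sup>2 * A \<le> p ^ 3 - r" using r by linarith
  have "0 \<le> p * A" using A by simp
  hence 2: "0 \<le> p\<^sup>2 - q" using q by (simp add: power2_eq_square algebra_simps)
  show "(real N)\<^sup>2 * real (Abar m a) / 36 \<le> (sigma_inv m a)\<^sup>2"
  proof -
    have "u / 36 \<le> v" if "u \<le> x" "0 \<le> y" "12 * v = x / 3 + y / 2" for u v x y :: real
      using that by linarith
    from this[OF 1 2 s] show ?thesis by (simp add: p A_def)
  qed
  have "p ^ 3 - r \<le> p ^ 3 - (p - A) ^ 3" using r by simp
  also have "\<dots> = 3 * (p\<^sup>2 * A) - A * A * (3 * p - A)"
    by (simp add: power2_eq_square power3_eq_cube algebra_simps)
  also have "\<dots> \<le> 3 * (p\<^sup>2 * A)" using A by simp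
  finally have 3: "p ^ 3 - r \<le> 3 * (p\<^sup>2 * A)" .
  have "p\<^sup>2 - q \<le> p\<^sup>2 - (p - A)\<^sup>2" using q by simp
  also have "\<dots> = 2 * p * A - A\<^sup>2" by (simp add: power2_eq_square algebra_simps)
  also have "\<dots> \<le> 2 * p * A" by simp
  also have "\<dots> \<le> 2 * (p\<^sup>2 * A)"
    using A mult_right_mono[of 1 p "p * A"] by (simp add: power2_eq_square mult.assoc)
  finally have 4: "p\<^sup>2 - q \<le> 2 * (p\<^sup>2 * A)" .
  show "(sigma_inv m a)\<^sup>2 \<le> (real N)\<^sup>2 * real (Abar m a) / 6"
  proof -
    have "v \<le> u / 6" if "x \<le> 3 * u" "y \<le> 2 * u" "12 * v = x / 3 + y / 2" for u v x y :: real
      using that by linarith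
    from this[OF 3 4 s] show ?thesis by (simp add: p A_def)
  qed
qed

section \<open>Expansion of the characteristic function near zero\<close>

definition ln_sinc :: "real \<Rightarrow> real" where
  "ln_sinc x = (if x = 0 then 0 else ln (sin x / x))"

text \<open>For \<open>y = sin x / x - 1\<close>, Taylor's formula gives
  \<open>- x\<^sup>2 / 6\<close> up to \<open>x ^ 4 / 120\<close>, so
  \<open>\<bar>y\<bar> \<le> x\<^sup>2 / 5\<close>. Replacing \<open>ln (1 + y)\<close> by
  \<open>y\<close> costs at most \<open>2 * y\<^sup>2\<close>, and
  \<open>1 / 120 + 2 / 25 < 1 / 10\<close>.\<close>

lemma ln_sinc:
  assumes x: "\<bar>x\<bar> \<le> 1 / 4"
  shows "sin x = x * exp (ln_sinc x)" and "\<bar>ln_sinc x + x\<^sup>2 / 6\<bar> \<le> x ^ 4 / 10"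
proof -
  have "sin x = x * exp (ln_sinc x) \<and> \<bar>ln_sinc x + x\<^sup>2 / 6\<bar> \<le> x ^ 4 / 10"
  proof (cases "x = 0")
    case False
    define y where "y = sin x / x - 1"
    have xx: "x\<^sup>2 \<le> 1 / 16" using power_mono[OF x, of 2] by (simp add: power2_eq_square)
    have x4: "x ^ 4 \<le> x\<^sup>2 / 16"
      using mult_left_mono[OF xx, of "x\<^sup>2"] by (simp add: power4_eq_xxxx power2_eq_square mult.assoc)
    have "(\<Sum>m<5. sin_coeff m * x ^ m) = x - x ^ 3 / 6"
      by (simp add: sin_coeff_def lessThan_nat_numeral fact_numeral)
    moreover have "inverse (fact 5) * \<bar>x\<bar> ^ 5 = \<bar>x\<bar> * (x ^ 4 / 120)"
      by (simp add: fact_numeral) (simp add: eval_nat_numeral abs_mult)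
    ultimately have "\<bar>sin x - (x - x ^ 3 / 6)\<bar> \<le> \<bar>x\<bar> * (x ^ 4 / 120)"
      using Maclaurin_sin_bound[of x 5] by simp
    moreover have "sin x - (x - x ^ 3 / 6) = x * (y + x\<^sup>2 / 6)"
    proof -
      have "x * y = sin x - x" using False by (simp add: y_def right_diff_distrib)
      thus ?thesis by (simp add: distrib_left power2_eq_square power3_eq_cube)
    qed
    ultimately have "\<bar>x\<bar> * \<bar>y + x\<^sup>2 / 6\<bar> \<le> \<bar>x\<bar> * (x ^ 4 / 120)"
      by (simp only: abs_mult)
    hence y: "\<bar>y + x\<^sup>2 / 6\<bar> \<le> x ^ 4 / 120" using False by simp
    hence y': "\<bar>y\<bar> \<le> x\<^sup>2 / 5" using x4 zero_le_power2[of x] by linarith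
    hence "\<bar>y\<bar> \<le> 1 / 2" using xx by linarith
    from abs_ln_one_plus_x_minus_x_bound[OF this] have "\<bar>ln (1 + y) - y\<bar> \<le> 2 * y\<^sup>2" .
    also have "y\<^sup>2 \<le> (x\<^sup>2 / 5)\<^sup>2" using y' by (metis abs_ge_zero power2_abs power_mono)
    also have "(x\<^sup>2 / 5)\<^sup>2 = x ^ 4 / 25" by (simp add: power_divide)
    finally have "\<bar>ln (1 + y) + x\<^sup>2 / 6\<bar> \<le> x ^ 4 / 10" using y by linarith
    moreover have "1 + y > 0" using \<open>\<bar>y\<bar> \<le> 1 / 2\<close> by linarith
    moreover have "1 + y = sin x / x" by (simp add: y_def)
    ultimately show ?thesis using False by (simp add: ln_sinc_def)
  qed (simp add: ln_sinc_def)
  thus "sin x = x * exp (ln_sinc x)" "\<bar>ln_sinc x + x\<^sup>2 / 6\<bar> \<le> x ^ 4 / 10" by auto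
qed

text \<open>The hypothesis keeps both half angles within \<open>1 / 4\<close>, where
  \<open>ln_sinc\<close> describes the sine. The definition of \<open>ln_sinc\<close> at
  \<open>0\<close> makes the formula hold at \<open>t = 0\<close> as well.\<close>

lemma qnum_cis_exp:
  assumes j: "j \<ge> 1" "real j * \<bar>t\<bar> \<le> 1 / 2"
  shows "qnum (cis t) j = of_nat j * cis ((real j - 1) * t / 2) *
    of_real (exp (ln_sinc (real j * t / 2) - ln_sinc (t / 2)))"
proof (cases "t = 0")
  case True
  thus ?thesis by (simp add: qnum_one ln_sinc_def)
next
  case False
  have "\<bar>t\<bar> \<le> real j * \<bar>t\<bar>" using j mult_right_mono[of 1 "real j" "\<bar>t\<bar>"] by simp
  moreover have "\<bar>t / 2\<bar> = \<bar>t\<bar> / 2" "\<bar>real j * t / 2\<bar> = real j * \<bar>t\<bar> / 2"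
    by (simp_all add: abs_mult)
  ultimately have t: "\<bar>t / 2\<bar> \<le> 1 / 4" "\<bar>real j * t / 2\<bar> \<le> 1 / 4"
    using j by linarith+
  let ?e = "of_real (t / 2) * of_real (exp (ln_sinc (t / 2))) :: complex"
  have "qnum (cis t) j * ?e =
      cis ((real j - 1) * t / 2) * (of_real (real j * t / 2) * of_real (exp (ln_sinc (real j * t / 2))))"
    using qnum_cis[of t j] unfolding ln_sinc(1)[OF t(1)] ln_sinc(1)[OF t(2)] of_real_mult .
  also have "\<dots> = of_nat j * cis ((real j - 1) * t / 2) *
    of_real (exp (ln_sinc (real j * t / 2) - ln_sinc (t / 2))) * ?e"
    by (simp add: exp_diff)
  finally show ?thesis using False by (subst (asm) mult_right_cancel) auto
qed

lemma qfact_cis_exp: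
  assumes n: "real n * \<bar>t\<bar> \<le> 1 / 2"
  shows "qfact (cis t) n = fact n * cis (real n * (real n - 1) / 4 * t) *
    of_real (exp (\<Sum>j=1..n. ln_sinc (real j * t / 2) - ln_sinc (t / 2)))"
  using n
proof (induction n)
  case (Suc n)
  let ?l = "\<lambda>j. ln_sinc (real j * t / 2) - ln_sinc (t / 2)"
  have "real n * \<bar>t\<bar> \<le> 1 / 2" using Suc.prems by (simp add: algebra_simps)
  note IH = Suc.IH[OF this]
  have "qfact (cis t) (Suc n) = fact (Suc n) *
      (cis ((real (Suc n) - 1) * t / 2) * cis (real n * (real n - 1) / 4 * t)) *
      of_real (exp (?l (Suc n)) * exp (\<Sum>j=1..n. ?l j))"
    unfolding qfact_Suc IH using Suc.prems by (subst qnum_cis_exp) (simp_all add: mult_ac)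
  also have "cis ((real (Suc n) - 1) * t / 2) * cis (real n * (real n - 1) / 4 * t) =
      cis (real (Suc n) * (real (Suc n) - 1) / 4 * t)"
    unfolding cis_mult by (simp add: field_simps)
  also have "exp (?l (Suc n)) * exp (\<Sum>j=1..n. ?l j) = exp (\<Sum>j=1..Suc n. ?l j)"
    by (simp add: mult.commute flip: exp_add)
  finally show ?case .
qed simp

lemma cis_sum: "finite A \<Longrightarrow> cis (\<Sum>i\<in>A. f i) = (\<Prod>i\<in>A. cis (f i))"
  by (induction A rule: finite_induct) (simp_all add: cis_mult[symmetric])

text \<open>In the quotient of q-factorials the phases \<open>n * (n - 1) / 4 * t\<close> combine to
  the mean, since the total squared minus the sum of the squares \<open>(a i)\<^sup>2\<close> is
  four times \<open>mu_inv m a\<close>. What remains is real and positive.\<close>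

lemma inv_gf_cis_exp:
  assumes t: "real (\<Sum>j=1..m. a j) * \<bar>t\<bar> \<le> 1 / 2"
  shows "inv_gf m a (cis t) = of_nat (card (words m a)) * cis (mu_inv m a * t) *
    of_real (exp (fact_diff m a (\<lambda>j. ln_sinc (real j * t / 2) - ln_sinc (t / 2))))"
proof -
  let ?N = "\<Sum>j=1..m. a j"
  let ?l = "\<lambda>j. ln_sinc (real j * t / 2) - ln_sinc (t / 2)"
  let ?c = "\<lambda>n. real n * (real n - 1) / 4 * t"
  define P C E where "P = (\<Prod>i=1..m. fact (a i) :: complex)"
    and "C = (\<Prod>i=1..m. cis (?c (a i)))"
    and "E = (\<Prod>i=1..m. complex_of_real (exp (\<Sum>j=1..a i. ?l j)))"
  have "qfact (cis t) (a i) = fact (a i) * cis (?c (a i)) * of_real (exp (\<Sum>j=1..a i. ?l j))"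
    if i: "i \<in> {1..m}" for i
  proof (rule qfact_cis_exp)
    have "a i \<le> ?N" using i by (intro member_le_sum) auto
    hence "real (a i) * \<bar>t\<bar> \<le> real ?N * \<bar>t\<bar>"
      by (intro mult_right_mono) (simp_all only: of_nat_le_iff abs_ge_zero)
    thus "real (a i) * \<bar>t\<bar> \<le> 1 / 2" using t by linarith
  qed
  hence prod: "(\<Prod>i=1..m. qfact (cis t) (a i)) = P * C * E"
    by (simp add: P_def C_def E_def prod.distrib)
  have nz: "P \<noteq> 0" "C \<noteq> 0" "E \<noteq> 0" by (simp_all add: P_def C_def E_def)
  have card: "of_nat (card (words m a)) * P = fact ?N"
    using inv_gf_qfact[of m a "1::complex"] by (simp add: inv_gf_one qfact_one P_def)
  have mu: "?c ?N = mu_inv m a * t + (\<Sum>i=1..m. ?c (a i))"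
  proof -
    have "(\<Sum>i=1..m. ?c (a i)) = (\<Sum>i=1..m. (real (a i))\<^sup>2 * (t / 4) - real (a i) * (t / 4))"
      by (intro sum.cong) (simp_all add: field_simps power2_eq_square)
    also have "\<dots> = psum m a 2 * (t / 4) - psum m a 1 * (t / 4)"
      unfolding psum_def sum_subtractf sum_distrib_right by simp
    also have "\<dots> = (psum m a 2 - psum m a 1) * t / 4"
      by (simp add: left_diff_distrib)
    finally have "(\<Sum>i=1..m. ?c (a i)) = (psum m a 2 - psum m a 1) * t / 4" .
    thus ?thesis
      unfolding mu_inv_def esym_psum psum_one[symmetric]
      by (simp add: field_simps power2_eq_square)
  qed
  have C: "cis (?c ?N) = cis (mu_inv m a * t) * C"
    unfolding mu C_def by (simp add: cis_sum flip: cis_mult)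
  have E: "complex_of_real (exp (\<Sum>j=1..?N. ?l j)) = of_real (exp (fact_diff m a ?l)) * E"
  proof -
    have "E = of_real (exp (\<Sum>i=1..m. \<Sum>j=1..a i. ?l j))"
      by (simp add: E_def exp_sum)
    thus ?thesis by (simp add: fact_diff_def flip: of_real_mult exp_add)
  qed
  have "inv_gf m a (cis t) * (P * C * E) =
     of_nat (card (words m a)) * P * (cis (mu_inv m a * t) * C) * (of_real (exp (fact_diff m a ?l)) * E)"
    unfolding prod[symmetric] inv_gf_qfact qfact_cis_exp[OF t] card C E ..
  also have "\<dots> = of_nat (card (words m a)) * cis (mu_inv m a * t) * of_real (exp (fact_diff m a ?l)) * (P * C * E)"
    by (simp only: mult_ac)
  finally show ?thesis using nz by simp
qed

lemma abs_exp_minus_one_le: "\<bar>exp x - 1\<bar> \<le> \<bar>x\<bar> * exp \<bar>x\<bar>" for x :: real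
proof (cases "x \<ge> 0")
  case True
  have "(1 - x) * exp x \<le> exp (- x) * exp x"
    using exp_ge_add_one_self[of "- x"] by (intro mult_right_mono) auto
  hence "exp x - x * exp x \<le> 1" by (simp add: left_diff_distrib flip: exp_add)
  moreover have "exp x \<ge> 1" using True by simp
  ultimately show ?thesis using True by simp
next
  case False
  have "1 - exp x \<le> - x" using exp_ge_add_one_self[of x] by linarith
  also have "\<dots> \<le> - x * exp (- x)" using False by simp
  finally show ?thesis using False by simp
qed

text \<open>The quadratic part of the exponent is the Gaussian one, and
  \<open>fact_diff_bound\<close> controls the remainder \<open>E\<close>. Since
  \<open>\<bar>E\<bar>\<close> is also at most half of the Gaussian exponent,
  \<open>exp \<bar>E\<bar>\<close> can be absorbed, which leaves the \<open>4\<close> in the final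
  exponential.\<close>

lemma inv_gf_gauss_approx:
  fixes a :: "nat \<Rightarrow> nat" and m :: nat
  defines "N \<equiv> \<Sum>j=1..m. a j"
  assumes m: "m \<ge> 1" and N: "N \<ge> 1" and t: "real N * \<bar>t\<bar> \<le> 1 / 2"
  shows "norm (inv_gf m a (cis t) / of_nat (card (words m a)) * cis (- (mu_inv m a * t))
      - of_real (exp (- ((sigma_inv m a)\<^sup>2 * t\<^sup>2 / 2))))
    \<le> real N ^ 4 * real (Abar m a) * t ^ 4 * exp (- ((sigma_inv m a)\<^sup>2 * t\<^sup>2 / 4))"
proof -
  define A s where "A = real (Abar m a)" and "s = (sigma_inv m a)\<^sup>2"
  \<comment> \<open>The remainder of \<open>ln_sinc\<close> beyond its quadratic term. The terms
    independent of \<open>j\<close> cancel under \<open>fact_diff\<close>, but including them makes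
    both halves of \<open>f j\<close> small.\<close>
  define f where "f j = (ln_sinc (real j * t / 2) + (real j * t / 2)\<^sup>2 / 6)
    - (ln_sinc (t / 2) + (t / 2)\<^sup>2 / 6)" for j
  define E where "E = fact_diff m a f"
  have "ln_sinc (real j * t / 2) - ln_sinc (t / 2) = (- (t\<^sup>2 / 24) * (real j)\<^sup>2 + t\<^sup>2 / 24) + f j" for j
    by (simp add: f_def field_simps power2_eq_square)
  hence D: "fact_diff m a (\<lambda>j. ln_sinc (real j * t / 2) - ln_sinc (t / 2)) = - (s * t\<^sup>2 / 2) + E"
    unfolding E_def s_def
    by (simp only: fact_diff_add fact_diff_cmult fact_diff_const fact_diff_squares) (simp add: field_simps)
  have A: "A \<ge> 0" by (simp add: A_def)
  have "\<bar>f j\<bar> \<le> real N ^ 4 * t ^ 4 / 80" if j: "1 \<le> j" "j \<le> N" for j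
  proof -
    have jn: "real i * \<bar>t\<bar> \<le> real N * \<bar>t\<bar>" if "i \<le> N" for i
      using that by (intro mult_right_mono) auto
    have b: "\<bar>ln_sinc (real i * t / 2) + (real i * t / 2)\<^sup>2 / 6\<bar> \<le> real N ^ 4 * t ^ 4 / 160"
      if i: "i \<le> N" for i
    proof -
      have "\<bar>real i * t / 2\<bar> = real i * \<bar>t\<bar> / 2" by (simp add: abs_mult)
      hence "\<bar>real i * t / 2\<bar> \<le> 1 / 4" using jn[OF i] t by linarith
      from ln_sinc(2)[OF this] have "\<bar>ln_sinc (real i * t / 2) + (real i * t / 2)\<^sup>2 / 6\<bar> \<le>
        (real i * t / 2) ^ 4 / 10" .
      also have "\<dots> = real i ^ 4 * t ^ 4 / 160" by (simp add: power_divide power_mult_distrib)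
      also have "\<dots> \<le> real N ^ 4 * t ^ 4 / 160"
        using i by (intro divide_right_mono mult_right_mono power_mono) auto
      finally show ?thesis .
    qed
    have "\<bar>f j\<bar> \<le> \<bar>ln_sinc (real j * t / 2) + (real j * t / 2)\<^sup>2 / 6\<bar> + \<bar>ln_sinc (t / 2) + (t / 2)\<^sup>2 / 6\<bar>"
      unfolding f_def by (rule abs_triangle_ineq4)
    thus ?thesis using b[OF j(2)] b[OF N] by simp
  qed
  hence "\<bar>E\<bar> \<le> 2 * A * (real N ^ 4 * t ^ 4 / 80)"
    unfolding E_def A_def N_def by (intro fact_diff_bound[OF m])
  hence E: "\<bar>E\<bar> \<le> real N ^ 4 * A * t ^ 4 / 40" by (simp add: mult_ac)
  \<comment> \<open>With \<open>u = (N * t)\<^sup>2 \<le> 1 / 4\<close> the bound on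
    \<open>E\<close> is at most \<open>A * u / 160\<close>, while the variance bound gives
    \<open>A * u \<le> 36 * (s * t\<^sup>2)\<close>; finally
    \<open>36 / 160 < 1 / 4\<close>.\<close>
  have E2: "\<bar>E\<bar> \<le> s * t\<^sup>2 / 4"
  proof -
    have "(real N * \<bar>t\<bar>)\<^sup>2 \<le> (1 / 2)\<^sup>2" using t by (intro power_mono) auto
    define u where "u = (real N)\<^sup>2 * t\<^sup>2"
    have u: "0 \<le> u" "u \<le> 1 / 4"
      using \<open>(real N * \<bar>t\<bar>)\<^sup>2 \<le> (1 / 2)\<^sup>2\<close>
      by (simp_all add: u_def power_mult_distrib power_divide)
    have "A * (u * u) \<le> A * (1 / 4 * u)"
      using u A by (intro mult_left_mono mult_right_mono)
    moreover have "real N ^ 4 * A * t ^ 4 = A * (u * u)"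
      by (simp add: u_def power4_eq_xxxx power2_eq_square)
    moreover have "A * u / 36 \<le> s * t\<^sup>2"
      using mult_right_mono[OF sigma_inv_bounds(1)[OF m N[unfolded N_def]], of "t\<^sup>2"]
      by (simp add: A_def s_def N_def u_def mult_ac)
    moreover have "0 \<le> A * u" using A u by simp
    ultimately show ?thesis using E by linarith
  qed
  have card: "of_nat (card (words m a)) \<noteq> (0::complex)"
    using words_nonempty finite_words by simp
  have "inv_gf m a (cis t) / of_nat (card (words m a)) * cis (- (mu_inv m a * t)) =
      of_real (exp (- (s * t\<^sup>2 / 2) + E))"
    unfolding inv_gf_cis_exp[OF t[unfolded N_def]] D using card
    by (simp add: cis_mult)
  hence "norm (inv_gf m a (cis t) / of_nat (card (words m a)) * cis (- (mu_inv m a * t))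
      - of_real (exp (- (s * t\<^sup>2 / 2)))) = \<bar>exp (- (s * t\<^sup>2 / 2) + E) - exp (- (s * t\<^sup>2 / 2))\<bar>"
    by (metis norm_of_real of_real_diff)
  also have "\<dots> = exp (- (s * t\<^sup>2 / 2)) * \<bar>exp E - 1\<bar>"
  proof -
    have "exp (- (s * t\<^sup>2 / 2) + E) - exp (- (s * t\<^sup>2 / 2)) = exp (- (s * t\<^sup>2 / 2)) * (exp E - 1)"
      unfolding exp_add by (simp add: right_diff_distrib)
    thus ?thesis by (simp add: abs_mult)
  qed
  also have "\<dots> \<le> exp (- (s * t\<^sup>2 / 2)) * (\<bar>E\<bar> * exp \<bar>E\<bar>)"
    by (intro mult_left_mono abs_exp_minus_one_le) auto
  also have "\<dots> = \<bar>E\<bar> * exp (- (s * t\<^sup>2 / 2) + \<bar>E\<bar>)"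
    unfolding exp_add by (rule mult.left_commute)
  also have "\<dots> \<le> (real N ^ 4 * A * t ^ 4) * exp (- (s * t\<^sup>2 / 4))"
  proof (rule mult_mono)
    show Q: "0 \<le> real N ^ 4 * A * t ^ 4" using A by simp
    show "\<bar>E\<bar> \<le> real N ^ 4 * A * t ^ 4" using E Q by linarith
    have "- (s * t\<^sup>2 / 2) + \<bar>E\<bar> \<le> - (s * t\<^sup>2 / 4)" using E2 by linarith
    thus "exp (- (s * t\<^sup>2 / 2) + \<bar>E\<bar>) \<le> exp (- (s * t\<^sup>2 / 4))" by simp
  qed simp
  finally show ?thesis unfolding s_def A_def .
qed

section \<open>The local limit theorem\<close>

lemma prob_inversions_fourier:
  fixes k :: int
  shows "has_bochner_integral lborel
    (\<lambda>t. indicator {-pi..pi} t *\<^sub>R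
      (inv_gf m a (cis t) / of_nat (card (words m a)) * cis (- (of_int k * t))))
    (complex_of_real (2 * pi * measure_pmf.prob (inversions_pmf m a) {x. int x = k}))"
proof -
  let ?n = "of_nat (card (words m a)) :: complex"
  have "(\<lambda>t. indicator {-pi..pi} t *\<^sub>R (inv_gf m a (cis t) / ?n * cis (- (of_int k * t)))) =
     (\<lambda>t. indicator {-pi..pi} t *\<^sub>R
       ((\<Sum>w\<in>words m a. 1 / ?n * cis t ^ inversions w) * cis (- (of_int k * t))))"
    by (simp add: inv_gf_def sum_divide_distrib)
  moreover have "measure_pmf.prob (inversions_pmf m a) {x. int x = k} =
      real (card {w\<in>words m a. int (inversions w) = k}) / real (card (words m a))"
    by (simp add: inversions_pmf_def measure_pmf_of_set finite_words words_nonempty vimage_def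
        Int_def)
  moreover have "(\<Sum>w\<in>words m a. if int (inversions w) = k then 1 / ?n else 0) =
      of_nat (card {w\<in>words m a. int (inversions w) = k}) / ?n"
    by (subst sum.inter_filter[symmetric]) (auto simp: finite_words)
  ultimately show ?thesis
    using fourier_coeff[where A = "words m a" and c = "\<lambda>_. 1 / ?n" and f = inversions and k = k]
    by simp
qed

text \<open>The characteristic function of the standard normal distribution at
  \<open>- x / s\<close>, after the substitution of \<open>s * t\<close> for the variable.\<close>

lemma gaussian_fourier:
  fixes s x :: real
  assumes s: "s > 0"
  shows "has_bochner_integral lborel (\<lambda>t. of_real (exp (- (s\<^sup>2 * t\<^sup>2 / 2))) * cis (- (x * t)))
    (complex_of_real (2 * pi * (1 / (sqrt (2 * pi) * s) * exp (- (x\<^sup>2 / (2 * s\<^sup>2))))))"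
proof -
  define u where "u = - x / s"
  let ?f = "\<lambda>y. std_normal_density y *\<^sub>R iexp (u * y)"
  have int: "integrable lborel ?f"
    by (rule Bochner_Integration.integrable_bound[of _ std_normal_density])
      (auto intro!: integrable_normal_density)
  have "(\<integral>y. ?f y \<partial>lborel) = char std_normal_distribution u"
    unfolding char_def by (subst integral_density) auto
  also have "\<dots> = of_real (exp (- (u\<^sup>2) / 2))" by (simp add: char_std_normal_distribution)
  finally have "has_bochner_integral lborel ?f (of_real (exp (- (u\<^sup>2) / 2)))"
    using has_bochner_integral_integrable[OF int] by simp
  hence "has_bochner_integral lborel (\<lambda>t. ?f (0 + s * t)) (of_real (exp (- (u\<^sup>2) / 2)) /\<^sub>R \<bar>s\<bar>)"
    using s by (subst (asm) lborel_has_bochner_integral_real_affine_iff[of s _ _ 0]) auto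
  hence "has_bochner_integral lborel (\<lambda>t. of_real (sqrt (2 * pi)) * ?f (0 + s * t))
      (of_real (sqrt (2 * pi)) * (of_real (exp (- (u\<^sup>2) / 2)) /\<^sub>R \<bar>s\<bar>))"
    by (rule has_bochner_integral_mult_right)
  moreover have "of_real (sqrt (2 * pi)) * ?f (0 + s * t) =
      of_real (exp (- (s\<^sup>2 * t\<^sup>2 / 2))) * cis (- (x * t))" for t
  proof -
    have "u * (s * t) = - (x * t)" using s by (simp add: u_def)
    thus ?thesis
      by (simp add: std_normal_density_def scaleR_conv_of_real power_mult_distrib cis_conv_exp
          flip: of_real_mult)
  qed
  moreover have "of_real (sqrt (2 * pi)) * (of_real (exp (- (u\<^sup>2) / 2)) /\<^sub>R \<bar>s\<bar>) =
      complex_of_real (2 * pi * (1 / (sqrt (2 * pi) * s) * exp (- (x\<^sup>2 / (2 * s\<^sup>2)))))"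
  proof -
    have "2 * pi / sqrt (2 * pi) = sqrt (2 * pi)" by (rule real_div_sqrt) simp
    moreover have "w * (1 / (r * s) * e) = w / r * (e / s)" for w r e :: real by simp
    moreover have "- (x\<^sup>2 / (2 * s\<^sup>2)) = - (u\<^sup>2) / 2" by (simp add: u_def power_divide)
    ultimately have "2 * pi * (1 / (sqrt (2 * pi) * s) * exp (- (x\<^sup>2 / (2 * s\<^sup>2)))) =
        sqrt (2 * pi) * (exp (- (u\<^sup>2) / 2) / s)"
      by (simp only:)
    thus ?thesis
      using s by (simp only: scaleR_conv_of_real of_real_mult of_real_divide abs_of_pos of_real_inverse
          divide_inverse mult.commute)
  qed
  ultimately show ?thesis by simp
qed

text \<open>Up to normalisation the exponential is the normal density with standard deviation
  \<open>sqrt 2 / s\<close>, whose fourth moment is known.\<close>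

lemma gaussian_fourth_moment:
  fixes s :: real
  assumes s: "s > 0"
  shows "has_bochner_integral lborel (\<lambda>t. t ^ 4 * exp (- (s\<^sup>2 * t\<^sup>2 / 4)))
    (12 * sqrt 2 * sqrt (2 * pi) / s ^ 5)"
proof -
  define r where "r = sqrt 2 / s"
  have r: "r > 0" "r\<^sup>2 = 2 / s\<^sup>2" using s by (simp_all add: r_def power_divide)
  have "has_bochner_integral lborel (\<lambda>t. normal_density 0 r t * (t - 0) ^ (2 * 2))
      (fact (2 * 2) / ((2 / r\<^sup>2)\<^sup>2 * fact 2))"
    by (rule normal_moment_even[OF r(1)])
  hence "has_bochner_integral lborel (\<lambda>t. sqrt (2 * pi * r\<^sup>2) * (normal_density 0 r t * (t - 0) ^ (2 * 2)))
      (sqrt (2 * pi * r\<^sup>2) * (fact (2 * 2) / ((2 / r\<^sup>2)\<^sup>2 * fact 2)))"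
    by (rule has_bochner_integral_mult_right)
  moreover have "sqrt (2 * pi * r\<^sup>2) * (normal_density 0 r t * (t - 0) ^ (2 * 2)) =
      t ^ 4 * exp (- (s\<^sup>2 * t\<^sup>2 / 4))" for t
    using r(1) s by (simp add: normal_density_def r(2) mult_ac)
  moreover have "sqrt (2 * pi * r\<^sup>2) * (fact (2 * 2) / ((2 / r\<^sup>2)\<^sup>2 * fact 2)) =
      12 * sqrt 2 * sqrt (2 * pi) / s ^ 5"
  proof -
    have "sqrt (2 * pi * r\<^sup>2) = sqrt (2 * pi) * (sqrt 2 / s)"
    proof -
      have "sqrt (2 * pi * r\<^sup>2) = sqrt (2 * pi) * sqrt (r\<^sup>2)" by (rule real_sqrt_mult)
      also have "sqrt (r\<^sup>2) = r" using r(1) by simp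
      finally show ?thesis by (simp add: r_def)
    qed
    moreover have "fact (2 * 2) / ((2 / r\<^sup>2)\<^sup>2 * fact 2) = 12 / s ^ 4"
      unfolding r(2) using s by (simp add: fact_numeral power2_eq_square power4_eq_xxxx)
    ultimately show ?thesis by (simp add: power4_eq_xxxx eval_nat_numeral mult_ac)
  qed
  ultimately show ?thesis by (simp only:)
qed

text \<open>The difference of the two Fourier integrals is dominated pointwise by \<open>Q\<close>
  plus the constant \<open>M\<close> on one period: \<open>Q\<close> covers the range
  \<open>N * \<bar>t\<bar> \<le> 1 / 2\<close> and the Gaussian tail, and \<open>M\<close> covers
  the characteristic function elsewhere.\<close>

lemma local_limit_bound:
  fixes a :: "nat \<Rightarrow> nat" and m :: nat and k :: int
  defines "N \<equiv> \<Sum>j=1..m. a j" and "A \<equiv> real (Abar m a)" and "s \<equiv> sigma_inv m a"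
  assumes m: "m \<ge> 1" and A: "Abar m a > 0" and s: "s > 0"
  shows "\<bar>measure_pmf.prob (inversions_pmf m a) {x. int x = k}
      - 1 / (sqrt (2 * pi) * s) * exp (- ((real_of_int k - mu_inv m a)\<^sup>2 / (2 * s\<^sup>2)))\<bar>
    \<le> 16 * (real N ^ 4 * A) * (12 * sqrt 2 * sqrt (2 * pi) / s ^ 5) / (2 * pi)
      + real (N + 1) * exp (- ((1 - cos (1 / 8)) / 6 * A))" (is "\<bar>?P - ?G\<bar> \<le> _")
proof -
  let ?\<phi> = "\<lambda>t. inv_gf m a (cis t) / of_nat (card (words m a))"
  let ?F = "\<lambda>t. indicator {-pi..pi} t *\<^sub>R (?\<phi> t * cis (- (of_int k * t)))"
  let ?H = "\<lambda>t. complex_of_real (exp (- (s\<^sup>2 * t\<^sup>2 / 2))) * cis (- ((real_of_int k - mu_inv m a) * t))"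
  define M where "M = real (N + 1) * exp (- ((1 - cos (1 / 8)) / 6 * A))"
  \<comment> \<open>The factor \<open>16\<close> lets \<open>Q\<close> dominate the Gaussian as well
    when \<open>N * \<bar>t\<bar> > 1 / 2\<close>, because then
    \<open>16 * N ^ 4 * t ^ 4 \<ge> 1\<close>. No separate tail estimate is required.\<close>
  define Q where "Q = (\<lambda>t. 16 * (real N ^ 4 * A) * (t ^ 4 * exp (- (s\<^sup>2 * t\<^sup>2 / 4))))"
  have N: "N \<ge> 1" using A by (simp add: Abar_def N_def)
  have A1: "A \<ge> 1" using A by (simp add: A_def)
  have card: "real (card (words m a)) > 0" using words_nonempty finite_words by (simp add: card_gt_0_iff)
  have M0: "M \<ge> 0" by (simp add: M_def)
  have i1: "has_bochner_integral lborel (\<lambda>t. ?F t - ?H t) (complex_of_real (2 * pi * ?P) - complex_of_real (2 * pi * ?G))"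
    by (intro has_bochner_integral_diff prob_inversions_fourier gaussian_fourier s)
  have i2: "has_bochner_integral lborel (\<lambda>t. Q t + M * indicator {-pi..pi} t)
      (16 * (real N ^ 4 * A) * (12 * sqrt 2 * sqrt (2 * pi) / s ^ 5) + M * (2 * pi))"
    unfolding Q_def using has_bochner_integral_real_indicator[of "{-pi..pi}" lborel]
    by (intro has_bochner_integral_add has_bochner_integral_mult_right gaussian_fourth_moment s) auto
  have bound: "norm (?F t - ?H t) \<le> Q t + M * indicator {-pi..pi} t" for t
  proof (cases "real N * \<bar>t\<bar> \<le> 1 / 2")
    case True
    have "\<bar>t\<bar> \<le> real N * \<bar>t\<bar>" using N mult_right_mono[of 1 "real N" "\<bar>t\<bar>"] by simp
    hence tpi: "t \<in> {-pi..pi}" using True pi_gt3 by auto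
    have "?F t - ?H t = (?\<phi> t * cis (- (mu_inv m a * t)) - of_real (exp (- (s\<^sup>2 * t\<^sup>2 / 2))))
       * cis (- ((real_of_int k - mu_inv m a) * t))"
    proof -
      have "cis (- (of_int k * t)) = cis (- (mu_inv m a * t)) * cis (- ((real_of_int k - mu_inv m a) * t))"
        unfolding cis_mult by (simp add: algebra_simps)
      thus ?thesis using tpi by (simp add: left_diff_distrib)
    qed
    hence "norm (?F t - ?H t) = norm (?\<phi> t * cis (- (mu_inv m a * t)) - of_real (exp (- (s\<^sup>2 * t\<^sup>2 / 2))))"
      by (simp add: norm_mult)
    also have "\<dots> \<le> real N ^ 4 * A * t ^ 4 * exp (- (s\<^sup>2 * t\<^sup>2 / 4))"
      unfolding N_def A_def s_def by (rule inv_gf_gauss_approx) (use m N True in \<open>auto simp: N_def\<close>)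
    also have "\<dots> \<le> Q t" using A1 by (simp add: Q_def mult_ac)
    finally have "norm (?F t - ?H t) \<le> Q t" .
    moreover have "0 \<le> M * indicator {-pi..pi} t" using M0 by simp
    ultimately show ?thesis by linarith
  next
    case False
    have "norm (?F t) \<le> M * indicator {-pi..pi} t"
    proof (cases "t \<in> {-pi..pi}")
      case True
      have "1 / (2 * real N) \<le> \<bar>t\<bar>" using False N by (simp add: field_simps)
      moreover have "\<bar>t\<bar> \<le> pi" using True by auto
      ultimately have "norm (inv_gf m a (cis t)) \<le> real (card (words m a)) * M"
        unfolding M_def N_def A_def by (rule norm_inv_gf_decay[OF m A])
      thus ?thesis using True card by (simp add: norm_mult norm_divide field_simps)
    qed simp
    moreover have "norm (?H t) \<le> Q t"
    proof -
      have "1 \<le> (2 * (real N * \<bar>t\<bar>)) ^ 4" using False by (intro one_le_power) simp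
      also have "\<dots> = 16 * (real N ^ 4 * t ^ 4)" by (simp add: power_mult_distrib)
      also have "\<dots> \<le> 16 * (real N ^ 4 * t ^ 4) * A"
        using A1 mult_left_mono[of 1 A "16 * (real N ^ 4 * t ^ 4)"] by simp
      finally have 1: "1 \<le> 16 * (real N ^ 4 * A) * t ^ 4" by (simp add: mult_ac)
      have "0 \<le> s\<^sup>2 * t\<^sup>2" by simp
      hence "norm (?H t) \<le> 1 * exp (- (s\<^sup>2 * t\<^sup>2 / 4))" by (simp add: norm_mult)
      also have "\<dots> \<le> (16 * (real N ^ 4 * A) * t ^ 4) * exp (- (s\<^sup>2 * t\<^sup>2 / 4))"
        using 1 by (intro mult_right_mono) auto
      finally show ?thesis by (simp add: Q_def mult_ac)
    qed
    ultimately show ?thesis using norm_triangle_ineq4[of "?F t" "?H t"] by linarith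
  qed
  have "norm (LINT t|lborel. ?F t - ?H t) \<le> (LINT t|lborel. Q t + M * indicator {-pi..pi} t)"
    by (rule Bochner_Integration.integral_norm_bound_integral)
      (use bound integrable.intros[OF i1] integrable.intros[OF i2] in auto)
  hence "norm (complex_of_real (2 * pi * ?P) - complex_of_real (2 * pi * ?G)) \<le>
      16 * (real N ^ 4 * A) * (12 * sqrt 2 * sqrt (2 * pi) / s ^ 5) + M * (2 * pi)"
    unfolding has_bochner_integral_integral_eq[OF i1] has_bochner_integral_integral_eq[OF i2] .
  also have "norm (complex_of_real (2 * pi * ?P) - complex_of_real (2 * pi * ?G)) = 2 * pi * \<bar>?P - ?G\<bar>"
    unfolding of_real_diff[symmetric] norm_of_real right_diff_distrib[symmetric] by (simp add: abs_mult)
  finally have *: "2 * pi * \<bar>?P - ?G\<bar> \<le>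
      16 * (real N ^ 4 * A) * (12 * sqrt 2 * sqrt (2 * pi) / s ^ 5) + M * (2 * pi)" .
  have "d \<le> x / p + y" if "p * d \<le> x + y * p" "p > 0" for d x y p :: real
    using that by (simp add: field_simps)
  from this[OF *] show ?thesis unfolding M_def by simp
qed

theorem theorem4p5:
  shows "\<exists>c>0. \<forall>C::real. \<exists>K::real. \<forall>(m::nat) (a::nat \<Rightarrow> nat) (k::int).
    m \<ge> 2 \<longrightarrow> (\<forall>j\<in>{1..m}. a j > 0) \<longrightarrow>
    real (Max (a ` {1..m})) \<le> C * exp (c * real (Abar m a)) \<longrightarrow>
    \<bar>measure_pmf.prob (inversions_pmf m a) {x. int x = k}
      - 1 / (sqrt (2 * pi) * sigma_inv m a) * exp (- ((real_of_int k - mu_inv m a)\<^sup>2 / (2 * (sigma_inv m a)\<^sup>2)))\<bar>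
    \<le> K / (sqrt (2 * pi) * sigma_inv m a * real (Abar m a))"
proof -
  \<comment> \<open>\<open>d\<close> is the decay rate in \<open>norm_inv_gf_decay\<close>. The last
    estimate must absorb two factors \<open>N\<close> and two factors \<open>A\<close>, each of
    order \<open>exp (c * A)\<close>, hence the quarter.\<close>
  define d c :: real where "d = (1 - cos (1 / 8)) / 6" and "c = d / 4"
  have "cos (1 / 8 :: real) < cos 0" using pi_gt3 by (intro cos_monotone_0_pi) auto
  hence c: "c > 0" "d = 4 * c" by (simp_all add: c_def d_def)
  show ?thesis
  proof (rule exI[of _ c], rule conjI[OF c(1)], rule allI)
    fix C :: real
    \<comment> \<open>In \<open>K1\<close>, \<open>1296 = 36\<^sup>2\<close> comes from the lower
      bound on the variance and the rest from \<open>local_limit_bound\<close>. In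
      \<open>K2\<close>, the \<open>6\<close> is \<open>3 * 2\<close>, from
      \<open>sqrt (2 * pi) \<le> 3\<close> and \<open>N + 1 \<le> 2 * N\<close>.\<close>
    define K1 K2 where "K1 = 16 * 12 * sqrt 2 * 1296" and "K2 = 6 * ((C + 1 / c)\<^sup>2 * (1 / c)\<^sup>2)"
    show "\<exists>K. \<forall>m a k. m \<ge> 2 \<longrightarrow> (\<forall>j\<in>{1..m}. a j > 0) \<longrightarrow>
      real (Max (a ` {1..m})) \<le> C * exp (c * real (Abar m a)) \<longrightarrow>
      \<bar>measure_pmf.prob (inversions_pmf m a) {x. int x = k}
        - 1 / (sqrt (2 * pi) * sigma_inv m a) * exp (- ((real_of_int k - mu_inv m a)\<^sup>2 / (2 * (sigma_inv m a)\<^sup>2)))\<bar>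
      \<le> K / (sqrt (2 * pi) * sigma_inv m a * real (Abar m a))"
    proof (intro exI[of _ "K1 + K2"] allI impI)
      fix m :: nat and a :: "nat \<Rightarrow> nat" and k :: int
      assume m: "m \<ge> 2" and pos: "\<forall>j\<in>{1..m}. a j > 0"
        and Max: "real (Max (a ` {1..m})) \<le> C * exp (c * real (Abar m a))"
      define N A s e where "N = (\<Sum>j=1..m. a j)" and "A = real (Abar m a)" and "s = sigma_inv m a"
        and "e = exp (c * A)"
      have "Max (a ` {1..m}) \<in> a ` {1..m}" using m by (intro Max_in) auto
      then obtain i where i: "i \<in> {1..m}" "a i = Max (a ` {1..m})" by auto
      have "N = a i + (\<Sum>j\<in>{1..m} - {i}. a j)" unfolding N_def using i by (intro sum.remove) auto
      hence NA: "N = a i + Abar m a" and "Abar m a = (\<Sum>j\<in>{1..m} - {i}. a j)"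
        using i by (auto simp: Abar_def N_def)
      \<comment> \<open>As \<open>m \<ge> 2\<close>, some letter other than \<open>i\<close> exists,
        and its positive multiplicity makes \<open>Abar m a\<close> positive.\<close>
      moreover have "{1..m} - {i} \<noteq> {}"
      proof -
        have "(if i = 1 then 2 else 1) \<in> {1..m} - {i}" using m by auto
        thus ?thesis by blast
      qed
      hence "0 < (\<Sum>j\<in>{1..m} - {i}. a j)" using pos by (intro sum_pos) auto
      ultimately have A: "Abar m a > 0" by simp
      hence A1: "A \<ge> 1" by (simp add: A_def)
      have N: "N \<ge> 1" using A NA by simp
      have m1: "m \<ge> 1" using m by simp
      note sb = sigma_inv_bounds[of m a, folded N_def, OF m1 N, folded A_def s_def]
      have "0 < (real N)\<^sup>2 * A / 36" using N A1 by simp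
      hence "s\<^sup>2 > 0" using sb(1) by linarith
      moreover have "s \<ge> 0" unfolding s_def by (rule sigma_inv_nonneg)
      ultimately have s: "s > 0" by (cases "s = 0") auto
      let ?D = "sqrt (2 * pi) * s * A"
      have D: "?D > 0" using s A1 by simp
      have "16 * (real N ^ 4 * A) * (12 * sqrt 2 * sqrt (2 * pi) / s ^ 5) / (2 * pi) \<le> K1 / ?D"
      proof -
        have "((real N)\<^sup>2 * A)\<^sup>2 \<le> (36 * s\<^sup>2)\<^sup>2"
          using sb(1) A1 by (intro power_mono) auto
        hence "real N ^ 4 * A * A \<le> 1296 * s ^ 4"
          by (simp add: power2_eq_square power4_eq_xxxx mult_ac)
        hence "real N ^ 4 * A / s ^ 4 \<le> 1296 / A" using A1 s by (simp add: field_simps)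
        hence "16 * 12 * sqrt 2 * (real N ^ 4 * A / s ^ 4) * (1 / (sqrt (2 * pi) * s)) \<le>
            16 * 12 * sqrt 2 * (1296 / A) * (1 / (sqrt (2 * pi) * s))"
          using s by (intro mult_right_mono mult_left_mono) auto
        moreover have "sqrt (2 * pi) / (2 * pi) = 1 / sqrt (2 * pi)"
          by (simp add: field_simps)
        hence "16 * (real N ^ 4 * A) * (12 * sqrt 2 * sqrt (2 * pi) / s ^ 5) / (2 * pi) =
            16 * 12 * sqrt 2 * (real N ^ 4 * A / s ^ 4) * (1 / (sqrt (2 * pi) * s))"
          using s by (simp add: field_simps power4_eq_xxxx eval_nat_numeral)
        ultimately show ?thesis by (simp add: K1_def mult_ac)
      qed
      moreover have "real (N + 1) * exp (- (d * A)) \<le> K2 / ?D"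
      proof -
        have "c * A \<le> e" using exp_ge_add_one_self[of "c * A"] unfolding e_def by linarith
        hence Ae: "A \<le> 1 / c * e" using c by (simp add: field_simps)
        \<comment> \<open>The growth hypothesis enters here: it bounds the largest multiplicity, and
          \<open>A\<close> is itself at most a multiple of \<open>e\<close>.\<close>
        have "real N = real (Max (a ` {1..m})) + A" by (simp add: NA i(2) A_def)
        also have "\<dots> \<le> C * e + 1 / c * e" using Max Ae by (simp add: A_def e_def)
        finally have Ne: "real N \<le> (C + 1 / c) * e" by (simp add: distrib_right)
        \<comment> \<open>A crude bound suffices, as every power of \<open>N\<close> and
          \<open>A\<close> is paid for by the exponential.\<close>
        have "s\<^sup>2 \<le> (real N * A)\<^sup>2"
        proof -
          have "(real N)\<^sup>2 * A / 6 \<le> (real N)\<^sup>2 * (A * A)"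
            using A1 mult_left_mono[of "A / 6" "A * A" "(real N)\<^sup>2"] mult_right_mono[of 1 A A] by simp
          thus ?thesis using sb(2) by (simp add: power2_eq_square mult_ac)
        qed
        hence sN: "s \<le> real N * A" by (rule power2_le_imp_le) (use A1 in auto)
        have "sqrt (2 * pi) \<le> sqrt (3\<^sup>2)" using pi_less_4 by (intro real_sqrt_le_mono) simp
        hence "sqrt (2 * pi) \<le> 3" by simp
        hence "?D * real (N + 1) \<le> (3 * (real N * A) * A) * (2 * real N)"
          using s sN N A1 by (intro mult_mono) auto
        also have "\<dots> = 6 * ((real N)\<^sup>2 * A\<^sup>2)" by (simp add: power2_eq_square)
        also have "\<dots> \<le> 6 * (((C + 1 / c) * e)\<^sup>2 * (1 / c * e)\<^sup>2)"
          using Ne Ae A1 by (intro mult_left_mono mult_mono power_mono) auto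
        also have "\<dots> = K2 * e ^ 4"
          unfolding K2_def power2_eq_square power4_eq_xxxx by (simp only: mult_ac)
        also have "e ^ 4 = exp (d * A)"
          using exp_of_nat_mult[of 4 "c * A"] by (simp add: e_def c(2) mult.assoc)
        finally have "?D * real (N + 1) * exp (- (d * A)) \<le> K2 * exp (d * A) * exp (- (d * A))"
          by (intro mult_right_mono) auto
        also have "\<dots> = K2 * (exp (d * A) * exp (- (d * A)))" by (rule mult.assoc)
        also have "exp (d * A) * exp (- (d * A)) = 1" by (simp flip: exp_add)
        finally show ?thesis using D by (simp add: field_simps)
      qed
      ultimately show "\<bar>measure_pmf.prob (inversions_pmf m a) {x. int x = k}
        - 1 / (sqrt (2 * pi) * sigma_inv m a) * exp (- ((real_of_int k - mu_inv m a)\<^sup>2 / (2 * (sigma_inv m a)\<^sup>2)))\<bar>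
      \<le> (K1 + K2) / (sqrt (2 * pi) * sigma_inv m a * real (Abar m a))"
        using local_limit_bound[of m a k, folded N_def A_def s_def d_def, OF m1 A s]
        unfolding A_def[symmetric] s_def[symmetric] add_divide_distrib by linarith
    qed
  qed
qed

end
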